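(* Let $G$ be a countable group which acts by isometries on a separable Gromov hyperbolic space $X$, and let $\mu$ be a non-elementary probability distribution on $G$. Then the translation length $\tau(w_n)$ of the group element $w_n$ grows at least linearly in $n$, i.e. $$\mathbb{P}(\tau(w_n)\le Ln)\to 0\quad\text{as } n\to\infty,$$ for some constant $L$ strictly greater than zero. If the support of $\mu$ is bounded in $X$ (i.e. $\{gx_0:\mu(g)>0\}$ is a bounded subset of $X$ for a basepoint $x_0\in X$), then there are constants $c<1$, $K$ and $L>0$ such that $$\mathbb{P}(\tau(w_n)\le Ln)\le Kc^n$$ for all $n$.
   Context: A Gromov hyperbolic space is a geodesic metric space $X$ for which there is $\delta\ge 0$ such that in every geodesic triangle each side is contained in a $\delta$-neighbourhood of the other two sides; $X$ is not assumed proper or locally compact. Its Gromov boundary $\partial X$ is the set of equivalence classes of sequences $(x_n)$ in $X$ with $(x_m\cdot x_n)_{x_0}\to\infty$ as $\min\{m,n\}\to\infty$, where $(x\cdot y)_{x_0}=\frac12(d_X(x_0,x)+d_X(x_0,y)-d_X(x,y))$ and $(x_n)\sim(y_n)$ if $(x_n\cdot y_n)_{x_0}\to\infty$. The action of a group on $X$ is non-elementary if the group contains a pair of elements acting as hyperbolic (loxodromic) isometries with disjoint fixed point sets in $\partial X$. A probability measure $\mu$ on $G$ is non-elementary if the semigroup generated by its support is a non-elementary subgroup of $G$. The random walk is $w_n=g_1g_2\cdots g_n$, where the $g_i$ are independent elements of $G$ with distribution $\mu$, and $\mathbb{P}$ is the resulting probability on sample paths. The translation length of an isometry $g$ of $X$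 is $\tau(g)=\lim_{n\to\infty}\frac1n d_X(x_0,g^nx_0)$, which does not depend on $x_0\in X$. *)

theory Defs
  imports "HOL-Probability.Probability" "HOL-Algebra.Group_Action"
begin

section \<open>Gromov hyperbolic spaces\<close>

text \<open>Metric spaces are types of class \<^class>\<open>metric_space\<close>; the space is the whole type.\<close>

definition geodesic_segment :: "'x::metric_space \<Rightarrow> 'x \<Rightarrow> 'x set \<Rightarrow> bool" where
  "geodesic_segment x y S \<longleftrightarrow>
     (\<exists>\<gamma> :: real \<Rightarrow> 'x. \<gamma> 0 = x \<and> \<gamma> (dist x y) = y \<and>
        (\<forall>s\<in>{0..dist x y}. \<forall>t\<in>{0..dist x y}. dist (\<gamma> s) (\<gamma> t) = \<bar>s - t\<bar>) \<and>
        S = \<gamma> ` {0..dist x y})"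

definition geodesic_space :: "'x::metric_space itself \<Rightarrow> bool" where
  "geodesic_space _ \<longleftrightarrow> (\<forall>x y :: 'x. \<exists>S. geodesic_segment x y S)"

definition nbhd :: "real \<Rightarrow> 'x::metric_space set \<Rightarrow> 'x set" where
  "nbhd \<delta> S = (\<Union>p\<in>S. cball p \<delta>)"

definition gromov_hyperbolic :: "'x::metric_space itself \<Rightarrow> bool" where
  "gromov_hyperbolic _ \<longleftrightarrow> geodesic_space TYPE('x) \<and>
     (\<exists>\<delta>\<ge>0. \<forall>(x::'x) y z A B C.
        geodesic_segment x y A \<and> geodesic_segment y z B \<and> geodesic_segment z x C \<longrightarrow>
        A \<subseteq> nbhd \<delta> (B \<union> C) \<and> B \<subseteq> nbhd \<delta> (C \<union> A) \<and> C \<subseteq> nbhd \<delta> (A \<union> B))"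

section \<open>The Gromov boundary\<close>

definition gromov_product :: "'x::metric_space \<Rightarrow> 'x \<Rightarrow> 'x \<Rightarrow> real" where
  "gromov_product x0 x y = (dist x0 x + dist x0 y - dist x y) / 2"

text \<open>Convergence along the product filter \<open>sequentially \<times>\<^sub>F sequentially\<close> is convergence as
  \<open>min m n\<close> tends to infinity.\<close>

definition gromov_sequence :: "'x::metric_space \<Rightarrow> (nat \<Rightarrow> 'x) \<Rightarrow> bool" where
  "gromov_sequence x0 u \<longleftrightarrow>
     filterlim (\<lambda>(m, n). gromov_product x0 (u m) (u n)) at_top (sequentially \<times>\<^sub>F sequentially)"

definition gromov_rel :: "'x::metric_space \<Rightarrow> ((nat \<Rightarrow> 'x) \<times> (nat \<Rightarrow> 'x)) set" where
  "gromov_rel x0 = {(u, v). gromov_sequence x0 u \<and> gromov_sequence x0 v \<and>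
     filterlim (\<lambda>n. gromov_product x0 (u n) (v n)) at_top sequentially}"

definition gromov_boundary :: "'x::metric_space \<Rightarrow> (nat \<Rightarrow> 'x) set set" where
  "gromov_boundary x0 = {u. gromov_sequence x0 u} // gromov_rel x0"

text \<open>A bijective isometry \<open>f\<close> sends the class of \<open>(x\<^sub>n)\<close> to the class of \<open>(f x\<^sub>n)\<close>, and the latter
  is exactly the image, under composition with \<open>f\<close>, of the former.\<close>

definition boundary_map :: "('x \<Rightarrow> 'x) \<Rightarrow> (nat \<Rightarrow> 'x) set \<Rightarrow> (nat \<Rightarrow> 'x) set" where
  "boundary_map f \<xi> = (\<lambda>u. f \<circ> u) ` \<xi>"

definition boundary_fixed_points :: "'x::metric_space \<Rightarrow> ('x \<Rightarrow> 'x) \<Rightarrow> (nat \<Rightarrow> 'x) set set" where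
  "boundary_fixed_points x0 f = {\<xi> \<in> gromov_boundary x0. boundary_map f \<xi> = \<xi>}"

section \<open>Translation length and non-elementary actions\<close>

definition translation_length :: "'x::metric_space \<Rightarrow> ('x \<Rightarrow> 'x) \<Rightarrow> real" where
  "translation_length x0 f = lim (\<lambda>n. dist x0 ((f ^^ n) x0) / real n)"

text \<open>Gromov's classification of isometries: elliptic (bounded orbits), parabolic (unbounded orbits,
  zero translation length), loxodromic (positive translation length).\<close>

definition loxodromic :: "'x::metric_space \<Rightarrow> ('x \<Rightarrow> 'x) \<Rightarrow> bool" where
  "loxodromic x0 f \<longleftrightarrow> translation_length x0 f > 0"

definition isometric_action ::
    "('g, 'b) monoid_scheme \<Rightarrow> ('g \<Rightarrow> 'x::metric_space \<Rightarrow> 'x) \<Rightarrow> bool" where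
  "isometric_action G \<phi> \<longleftrightarrow> group_action G UNIV \<phi> \<and>
     (\<forall>g\<in>carrier G. \<forall>x y. dist (\<phi> g x) (\<phi> g y) = dist x y)"

definition non_elementary :: "'x::metric_space \<Rightarrow> ('g \<Rightarrow> 'x \<Rightarrow> 'x) \<Rightarrow> 'g set \<Rightarrow> bool" where
  "non_elementary x0 \<phi> H \<longleftrightarrow>
     (\<exists>g\<in>H. \<exists>h\<in>H. loxodromic x0 (\<phi> g) \<and> loxodromic x0 (\<phi> h) \<and>
        boundary_fixed_points x0 (\<phi> g) \<inter> boundary_fixed_points x0 (\<phi> h) = {})"

section \<open>Random walks\<close>

text \<open>A probability measure on the countable discrete group \<open>G\<close> has \<^term>\<open>carrier G\<close> as
  underlying space, with all subsets measurable. All events that depend on finitely many steps are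
  then measurable in the product space \<open>step_space\<close>.\<close>

definition prob_measure_on :: "('g, 'b) monoid_scheme \<Rightarrow> 'g measure \<Rightarrow> bool" where
  "prob_measure_on G \<mu> \<longleftrightarrow> prob_space \<mu> \<and> sets \<mu> = Pow (carrier G)"

definition atoms :: "'g measure \<Rightarrow> 'g set" where
  "atoms \<mu> = {g \<in> space \<mu>. measure \<mu> {g} > 0}"

inductive_set generated_semigroup :: "('g, 'b) monoid_scheme \<Rightarrow> 'g set \<Rightarrow> 'g set"
  for G (structure) and S where
  incl: "s \<in> S \<Longrightarrow> s \<in> generated_semigroup G S"
| mult: "a \<in> generated_semigroup G S \<Longrightarrow> b \<in> generated_semigroup G S \<Longrightarrow>
         a \<otimes> b \<in> generated_semigroup G S"

definition non_elementary_measure ::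
    "('g, 'b) monoid_scheme \<Rightarrow> 'x::metric_space \<Rightarrow> ('g \<Rightarrow> 'x \<Rightarrow> 'x) \<Rightarrow> 'g measure \<Rightarrow> bool" where
  "non_elementary_measure G x0 \<phi> \<mu> \<longleftrightarrow>
     subgroup (generated_semigroup G (atoms \<mu>)) G \<and>
     non_elementary x0 \<phi> (generated_semigroup G (atoms \<mu>))"

definition step_space :: "'g measure \<Rightarrow> (nat \<Rightarrow> 'g) measure" where
  "step_space \<mu> = PiM UNIV (\<lambda>_. \<mu>)"

text \<open>Steps are indexed from 0: \<open>\<omega> i\<close> is the increment \<open>g\<^bsub>i+1\<^esub>\<close>, so \<open>random_walk G \<omega> n\<close> is the
  product \<open>g\<^sub>1 \<dots> g\<^sub>n\<close>.\<close>

primrec random_walk :: "('g, 'b) monoid_scheme \<Rightarrow> (nat \<Rightarrow> 'g) \<Rightarrow> nat \<Rightarrow> 'g" where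
  "random_walk G \<omega> 0 = \<one>\<^bsub>G\<^esub>"
| "random_walk G \<omega> (Suc n) = random_walk G \<omega> n \<otimes>\<^bsub>G\<^esub> \<omega> n"

definition short_translation_prob ::
    "('g, 'b) monoid_scheme \<Rightarrow> 'x::metric_space \<Rightarrow> ('g \<Rightarrow> 'x \<Rightarrow> 'x) \<Rightarrow> 'g measure \<Rightarrow> real \<Rightarrow> nat \<Rightarrow> real" where
  "short_translation_prob G x0 \<phi> \<mu> L n =
     measure (step_space \<mu>)
       {\<omega> \<in> space (step_space \<mu>). translation_length x0 (\<phi> (random_walk G \<omega> n)) \<le> L * real n}"

end

theory Submission
  imports Defs
begin

text \<open>
  The proof is a finite, quantitative form of Gouezel's pivoting argument. Powers of the two given
  loxodromic elements play ping-pong, which yields 200 elements of the semigroup, all of the same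
  word length, such that for any points \<open>x, y\<close> at most two of them, \<open>s\<close> say, have a large product
  \<open>(x | s y)\<close> (a Schottky family). In a walk of which a positive proportion of the blocks are pairs
  of uniformly random letters of this family, with arbitrary group elements in between, the first
  letter of a pair extends a local quasi-geodesic with high probability and is then recorded as a
  pivot. If a later step spoils the alignment, pivots are discarded from the top; conditioning on
  the value of a discarded pivot restores the alignment with high probability, so \<open>4\<^sup>-\<^sup>p\<close>, where \<open>p\<close>
  is the number of pivots, contracts in the mean. Pivots give linear
  progress, and one surviving pivot bounds Gromov products with an arbitrary point, uniformly in
  the later part of the walk.

  The translation length is reduced to these two estimates by writing \<open>w\<^sub>n = u v\<close> with independent
  halves: if \<open>u\<close> and \<open>v\<close> are long and the products \<open>(u\<inverse> x\<^sub>0 | v x\<^sub>0)\<close> and \<open>(v\<inverse> x\<^sub>0 | u x\<^sub>0)\<close>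
  are small, then so is \<open>(w\<^sub>n\<inverse> x\<^sub>0 | w\<^sub>n x\<^sub>0)\<close>, and \<open>w\<^sub>n\<close> translates by almost \<open>d(x\<^sub>0, w\<^sub>n x\<^sub>0)\<close>.
\<close>

text \<open>\<open>X\<close> need not be proper, and the measure may have infinite support without
  moments, so neither compactness nor a finite drift can be relied on. Every estimate is an
  inequality for a finite set \<open>H\<close> of steps of total weight at most 1, with constants
  independent of \<open>H\<close>; the full measure enters only at the end. Pivots are not followed
  as a random process. The contraction acts backwards on functions: a bound by \<beta> divided by 4
  to the number of pivots, valid for the mean over every clean state, survives one more block of
  steps with a smaller \<beta>. Linear progress needs no bound on the steps, because a pivot is
  worth distance 1 however long the steps around it are. The product estimate does need one: a
  surviving pivot controls only what follows \<open>base\<close>, and the length of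
  \<open>base\<close> must be bounded. Long steps are therefore cut off at the price of their
  weight. With bounded support nothing is cut off, the number of blocks may grow with
  \<open>n\<close>, and the rate becomes exponential. In each of the two products of the halves one
  half is frozen and the other is a forward walk seen from an arbitrary point \<open>z\<close>, so
  no walk of inverses has to be studied.\<close>

section \<open>The isometry group\<close>

text \<open>Composition is written additively, since \<^class>\<open>group_add\<close> is the only type class of
  not necessarily commutative groups.\<close>

typedef (overloaded) ('x::metric_space) isom =
  "{f :: 'x \<Rightarrow> 'x. bij f \<and> (\<forall>x y. dist (f x) (f y) = dist x y)}"
  morphisms app Isom
  by (rule exI[of _ id]) auto

notation app (infixr "\<triangleright>" 75)

setup_lifting type_definition_isom

instantiation isom :: (metric_space) group_add
begin

lift_definition zero_isom :: "'a isom" is "\<lambda>x. x" by (auto simp: bij_id[unfolded id_def])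

lift_definition plus_isom :: "'a isom \<Rightarrow> 'a isom \<Rightarrow> 'a isom" is "\<lambda>f g x. f (g x)"
  by (auto intro: bij_comp[unfolded comp_def])

lift_definition uminus_isom :: "'a isom \<Rightarrow> 'a isom" is "inv_into UNIV"
  by (auto simp: bij_imp_bij_inv) (metis bij_inv_eq_iff)

definition minus_isom :: "'a isom \<Rightarrow> 'a isom \<Rightarrow> 'a isom" where
  "minus_isom f g = f + - g"

instance
proof
  fix a b c :: "'a isom"
  show "a + b + c = a + (b + c)" by transfer (simp add: o_assoc)
  show "0 + a = a" by transfer simp
  show "a + 0 = a" by transfer simp
  show "- a + a = 0" by transfer (simp add: bij_is_inj)
  show "a + - b = a - b" by (simp add: minus_isom_def)
qed

end

lemma app_plus [simp]: "(f + g) \<triangleright> x = f \<triangleright> g \<triangleright> x"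
  by transfer simp

lemma app_zero [simp]: "0 \<triangleright> x = x"
  by transfer simp

lemma app_uminus [simp]: "- f \<triangleright> f \<triangleright> x = x" "f \<triangleright> - f \<triangleright> x = x"
  by (metis app_plus app_zero left_minus) (metis app_plus app_zero right_minus)

lemma dist_app [simp]: "dist (f \<triangleright> x) (f \<triangleright> y) = dist x y"
  by transfer simp

lemma dist_app_left: "dist (f \<triangleright> x) y = dist x (- f \<triangleright> y)"
  by (metis app_uminus(1) dist_app)

section \<open>The four-point inequality\<close>

lemma geodesic_segment_commute:
  assumes "geodesic_segment x y S"
  shows "geodesic_segment y x S"
proof -
  obtain \<gamma> where \<gamma>: "\<gamma> 0 = x" "\<gamma> (dist x y) = y"
      "\<And>s t. s \<in> {0..dist x y} \<Longrightarrow> t \<in> {0..dist x y} \<Longrightarrow> dist (\<gamma> s) (\<gamma> t) = \<bar>s - t\<bar>"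
      "S = \<gamma> ` {0..dist x y}"
    using assms unfolding geodesic_segment_def by auto
  define d where "d = dist x y"
  have "S = (\<lambda>t. \<gamma> (d - t)) ` {0..d}"
  proof -
    have "(\<lambda>t. d - t) ` {0..d} = {0..d}"
      using image_diff_atLeastAtMost[of d 0 d] by simp
    then show ?thesis
      using \<gamma>(4) by (metis (no_types, lifting) d_def image_cong image_image)
  qed
  then show ?thesis
    unfolding geodesic_segment_def using \<gamma>
    by (intro exI[of _ "\<lambda>t. \<gamma> (d - t)"]) (auto simp: d_def dist_commute)
qed

lemma geodesic_segment_point:
  assumes "geodesic_segment x y S" "0 \<le> t" "t \<le> dist x y"
  obtains p where "p \<in> S" "dist x p = t" "dist p y = dist x y - t"
proof -
  obtain \<gamma> where \<gamma>: "\<gamma> 0 = x" "\<gamma> (dist x y) = y"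
      "\<And>s t. s \<in> {0..dist x y} \<Longrightarrow> t \<in> {0..dist x y} \<Longrightarrow> dist (\<gamma> s) (\<gamma> t) = \<bar>s - t\<bar>"
      "S = \<gamma> ` {0..dist x y}"
    using assms unfolding geodesic_segment_def by auto
  show ?thesis
    using \<gamma>(3)[of 0 t] \<gamma>(3)[of t "dist x y"] assms
    by (intro that[of "\<gamma> t"]) (auto simp: \<gamma>(1,2,4))
qed

lemma geodesic_segment_dist_add:
  assumes "geodesic_segment x y S" "p \<in> S"
  shows "dist x p + dist p y = dist x y"
proof -
  obtain \<gamma> where \<gamma>: "\<gamma> 0 = x" "\<gamma> (dist x y) = y"
      "\<And>s t. s \<in> {0..dist x y} \<Longrightarrow> t \<in> {0..dist x y} \<Longrightarrow> dist (\<gamma> s) (\<gamma> t) = \<bar>s - t\<bar>"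
      "S = \<gamma> ` {0..dist x y}"
    using assms unfolding geodesic_segment_def by auto
  obtain t where t: "p = \<gamma> t" "t \<in> {0..dist x y}" using assms(2) \<gamma>(4) by auto
  show ?thesis
    using \<gamma>(3)[of 0 t] \<gamma>(3)[of t "dist x y"] t by (auto simp: \<gamma>(1,2))
qed

lemma gromov_product_le_dist_segment:
  assumes "geodesic_segment x y S" "q \<in> S"
  shows "gromov_product w x y \<le> dist w q"
  using geodesic_segment_dist_add[OF assms] dist_triangle[of w x q] dist_triangle[of w y q]
  by (simp add: gromov_product_def dist_commute[of q])

definition four_point :: "'x::metric_space itself \<Rightarrow> real \<Rightarrow> bool" where
  "four_point _ \<delta> \<longleftrightarrow> (\<forall>w x y z :: 'x.
     min (gromov_product w x y) (gromov_product w y z) - \<delta> \<le> gromov_product w x z)"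

text \<open>Up to 2\<delta>, the product of \<open>x\<close> and \<open>z\<close> at
  \<open>w\<close> is the distance from \<open>w\<close> to a side joining them. Slimness moves the
  nearly closest point by \<delta> to another side, where the distance to \<open>w\<close> bounds
  the product for that side from above; hence 3\<delta>.\<close>

lemma gromov_hyperbolic_imp_four_point:
  assumes "gromov_hyperbolic TYPE('x::metric_space)"
  shows "\<exists>\<delta>\<ge>0. four_point TYPE('x) \<delta>"
proof -
  obtain \<delta> where \<delta>: "\<delta> \<ge> 0" and
    all: "\<forall>(x::'x) y z A B C.
        geodesic_segment x y A \<and> geodesic_segment y z B \<and> geodesic_segment z x C \<longrightarrow>
        A \<subseteq> nbhd \<delta> (B \<union> C) \<and> B \<subseteq> nbhd \<delta> (C \<union> A) \<and> C \<subseteq> nbhd \<delta> (A \<union> B)"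
    using assms unfolding gromov_hyperbolic_def by (elim conjE exE) (rule that)
  have slim: "A \<subseteq> nbhd \<delta> (B \<union> C)"
    if "geodesic_segment x y A" "geodesic_segment y z B" "geodesic_segment z x C"
    for x y z :: 'x and A B C
    using all[rule_format, OF conjI, OF that(1) conjI, OF that(2,3)] by (rule conjunct1)
  have ex: "\<exists>S. geodesic_segment x y S" for x y :: 'x
    using assms unfolding gromov_hyperbolic_def geodesic_space_def by blast
  have near: "\<exists>p\<in>S. dist w p \<le> gromov_product w x z + 2 * \<delta>"
    if S: "geodesic_segment x z S" for w x z :: 'x and S
  proof -
    \<comment> \<open>The point at this distance from \<open>x\<close> is where the inscribed circle
      touches the side; a nearby point on either other side then gives the same bound.\<close>
    define t where "t = gromov_product x w z"
    have "0 \<le> t" "t \<le> dist x z"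
      using dist_triangle[of w z x] dist_triangle[of x w z]
      by (auto simp: t_def gromov_product_def dist_commute[of w])
    then obtain p where p: "p \<in> S" "dist x p = t" "dist p z = dist x z - t"
      using geodesic_segment_point[OF S] by metis
    obtain B C where B: "geodesic_segment z w B" and C: "geodesic_segment w x C"
      using ex by blast
    obtain q where q: "q \<in> B \<union> C" "dist q p \<le> \<delta>"
      using subsetD[OF slim[OF S B C] p(1)] unfolding nbhd_def by auto
    have "dist w p \<le> gromov_product w x z + 2 * \<delta>"
    proof (cases "q \<in> B")
      case True
      show ?thesis
        using geodesic_segment_dist_add[OF B True] q(2) p(2,3) dist_triangle[of p z q]
          dist_triangle[of w p q] dist_commute[of w q] dist_commute[of w z] dist_commute[of w x]
          dist_commute[of z q] dist_commute[of p q]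
        unfolding t_def gromov_product_def by argo
    next
      case False
      then have "q \<in> C" using q by auto
      show ?thesis
        using geodesic_segment_dist_add[OF C \<open>q \<in> C\<close>] q(2) p(2,3) dist_triangle[of x p q]
          dist_triangle[of w p q] dist_commute[of q x] dist_commute[of x w]
        unfolding t_def gromov_product_def by argo
    qed
    then show ?thesis using p(1) by blast
  qed
  have "min (gromov_product w x y) (gromov_product w y z) - 3 * \<delta> \<le> gromov_product w x z"
    for w x y z :: 'x
  proof -
    obtain A B C where A: "geodesic_segment x z A" and B: "geodesic_segment z y B"
      and C: "geodesic_segment y x C"
      using ex by metis
    obtain p where p: "p \<in> A" "dist w p \<le> gromov_product w x z + 2 * \<delta>" using near[OF A] by blast
    obtain q where q: "q \<in> B \<union> C" "dist q p \<le> \<delta>"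
      using subsetD[OF slim[OF A B C] p(1)] unfolding nbhd_def by auto
    have "gromov_product w y z \<le> dist w q \<or> gromov_product w x y \<le> dist w q"
      using q(1) gromov_product_le_dist_segment[OF geodesic_segment_commute[OF B], of q w]
        gromov_product_le_dist_segment[OF geodesic_segment_commute[OF C], of q w] by blast
    then show ?thesis
      using p(2) q(2) dist_triangle[of w q p] dist_commute[of q p] by linarith
  qed
  then show ?thesis
    using \<delta> by (intro exI[of _ "3 * \<delta>"]) (simp add: four_point_def)
qed

section \<open>Translation lengths\<close>

text \<open>Fekete's lemma. The limit is the infimum of the quotients, whence the lower bound valid
  for every \<open>n\<close>, which later forces orbits of loxodromic elements to grow.\<close>

lemma subadditive_limit:
  fixes a :: "nat \<Rightarrow> real"
  assumes sub: "\<And>m n. a (m + n) \<le> a m + a n" and nonneg: "\<And>n. 0 \<le> a n"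
  shows "\<exists>l. (\<lambda>n. a n / real n) \<longlonglongrightarrow> l \<and> (\<forall>n. real n * l \<le> a n)"
proof -
  define l where "l = (INF n\<in>{1..}. a n / real n)"
  have bdd: "bdd_below ((\<lambda>n. a n / real n) ` {1..})"
    using nonneg by (auto intro!: bdd_belowI[of _ 0])
  have lower: "l \<le> a n / real n" if "n \<ge> 1" for n
    unfolding l_def using that bdd by (auto intro!: cINF_lower)
  have mult: "a (q * m + r) \<le> real q * a m + a r" for q m r
  proof (induction q)
    case (Suc q)
    have "a (Suc q * m + r) = a (m + (q * m + r))" by (simp add: algebra_simps)
    also have "\<dots> \<le> a m + a (q * m + r)" by (rule sub)
    finally show ?case using Suc by (simp add: algebra_simps)
  qed simp
  have "(\<lambda>n. a n / real n) \<longlonglongrightarrow> l"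
  proof (rule LIMSEQ_I)
    fix e :: real assume e: "e > 0"
    obtain m where m: "m \<ge> 1" "a m / real m < l + e / 2"
      using cInf_lessD[of "(\<lambda>n. a n / real n) ` {1..}" "l + e / 2"] e unfolding l_def by fastforce
    define K where "K = (\<Sum>r<m. a r)"
    have K: "a r \<le> K" if "r < m" for r
      unfolding K_def using that nonneg by (intro member_le_sum) auto
    obtain n0 :: nat where n0: "real n0 > 2 * K / e" using reals_Archimedean2 by blast
    show "\<exists>no. \<forall>n\<ge>no. norm (a n / real n - l) < e"
    proof (intro exI allI impI)
      fix n assume n: "n \<ge> max 1 n0"
      have "a n \<le> real (n div m) * a m + K"
        using mult[of "n div m" m "n mod m"] K[of "n mod m"] m by (simp add: field_simps)
      also have "real (n div m) * a m \<le> (real n / real m) * a m"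
        using nonneg[of m] by (intro mult_right_mono of_nat_div_le_of_nat) auto
      finally have "a n / real n \<le> a m / real m + K / real n"
        using n m by (simp add: field_simps)
      moreover have "K / real n < e / 2"
      proof -
        have "2 * K / e < real n" using n0 n by linarith
        then show ?thesis using e n by (simp add: field_simps)
      qed
      moreover have "l \<le> a n / real n" using lower n by simp
      ultimately show "norm (a n / real n - l) < e" using m(2) unfolding real_norm_def by linarith
    qed
  qed
  moreover have "real n * l \<le> a n" for n
    using lower[of n] nonneg[of 0] by (cases "n = 0") (auto simp: field_simps)
  ultimately show ?thesis by blast
qed

text \<open>Powers are sums of constant lists, so that they are words to which the chain estimates
  apply.\<close>

abbreviation iter :: "nat \<Rightarrow> 'x::metric_space isom \<Rightarrow> 'x isom" where
  "iter n g \<equiv> sum_list (replicate n g)"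

lemma iter_add: "iter (m + n) g = iter m g + iter n g"
  by (simp add: replicate_add)

lemma iter_mult: "iter (m * n) g = iter m (iter n g)"
  by (induction m) (simp_all add: iter_add)

lemma iter_Suc_right: "iter (Suc n) g = iter n g + g"
  using iter_add[of n 1 g] by simp

lemma iter_uminus: "iter n (- g) = - iter n g"
proof (induction n)
  case (Suc n)
  have "- iter (Suc n) g = - (iter n g + g)" by (simp only: iter_Suc_right)
  also have "\<dots> = - g + - iter n g" by (simp add: minus_add)
  finally show ?case using Suc by simp
qed simp

lemma app_iter: "iter n g \<triangleright> x = (app g ^^ n) x"
  by (induction n) simp_all

lemma translation_length_limit:
  fixes g :: "'x::metric_space isom"
  shows "(\<lambda>n. dist x (iter n g \<triangleright> x) / real n) \<longlonglongrightarrow> translation_length x (app g)"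
    and "real n * translation_length x (app g) \<le> dist x (iter n g \<triangleright> x)"
proof -
  have "dist x (iter (m + n) g \<triangleright> x) \<le> dist x (iter m g \<triangleright> x) + dist x (iter n g \<triangleright> x)" for m n
    using dist_triangle[of x "iter m g \<triangleright> iter n g \<triangleright> x" "iter m g \<triangleright> x"] by (simp add: iter_add)
  from subadditive_limit[of "\<lambda>n. dist x (iter n g \<triangleright> x)", OF this]
  obtain l where l: "(\<lambda>n. dist x (iter n g \<triangleright> x) / real n) \<longlonglongrightarrow> l"
    "\<And>n. real n * l \<le> dist x (iter n g \<triangleright> x)"
    by auto
  have "translation_length x (app g) = l"
    using limI[OF l(1)] by (simp add: translation_length_def app_iter)
  then show "(\<lambda>n. dist x (iter n g \<triangleright> x) / real n) \<longlonglongrightarrow> translation_length x (app g)"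
    "real n * translation_length x (app g) \<le> dist x (iter n g \<triangleright> x)" using l by auto
qed

section \<open>Gromov products and chains\<close>

locale four_point_space =
  fixes x0 :: "'x::metric_space" and \<delta> :: real
  assumes delta_nonneg: "0 \<le> \<delta>" and four_point: "four_point TYPE('x) \<delta>"
begin

abbreviation ip :: "'x \<Rightarrow> 'x \<Rightarrow> real" where
  "ip \<equiv> gromov_product x0"

abbreviation pt :: "'x isom \<Rightarrow> 'x" where
  "pt g \<equiv> g \<triangleright> x0"

abbreviation len :: "'x isom \<Rightarrow> real" where
  "len g \<equiv> dist x0 (pt g)"

lemma ip_commute: "ip x y = ip y x"
  by (simp add: gromov_product_def dist_commute)

lemma ip_nonneg: "0 \<le> ip x y"
  using dist_triangle[of x y x0] by (simp add: gromov_product_def dist_commute[of x x0])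

lemma ip_le_left: "ip x y \<le> dist x0 x"
  using dist_triangle[of x0 y x] by (simp add: gromov_product_def)

lemma ip_le_right: "ip x y \<le> dist x0 y"
  using ip_le_left[of y x] by (simp add: ip_commute)

lemma ip_base [simp]: "ip x0 y = 0" "ip y x0 = 0"
  by (simp_all add: gromov_product_def dist_commute)

lemma ip_ge: "dist x0 x - dist x y \<le> ip x y"
  using dist_triangle[of x0 x y] by (simp add: gromov_product_def dist_commute[of y x])

lemma ip_hyperbolic: "min (ip x y) (ip y z) - \<delta> \<le> ip x z"
  using four_point unfolding four_point_def by blast

lemma dist_ip: "dist x y = dist x0 x + dist x0 y - 2 * ip x y"
  by (simp add: gromov_product_def field_simps)

lemma len_uminus [simp]: "len (- g) = len g"
  using dist_app_left[of g x0 x0] by (simp add: dist_commute)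

lemma len_plus: "len (g + h) \<le> len g + len h"
  using dist_triangle[of x0 "pt (g + h)" "pt g"] by simp

text \<open>The products at the two ends of the segment from \<open>x0\<close> to
  \<open>pt e\<close>, each taken between the other end and \<open>e \<triangleright> y\<close>, add
  up to its length; the second one is moved back to \<open>x0\<close> by \<open>- e\<close>.\<close>

lemma ip_translate: "ip (pt e) (e \<triangleright> y) = len e - ip (pt (- e)) y"
  using dist_app_left[of "- e" x0 y] dist_app_left[of "e" y x0] len_uminus[of e]
  by (simp add: gromov_product_def dist_commute field_simps)

lemma dist_base_app: "dist x0 (g \<triangleright> x) \<le> len g + dist x0 x" "dist x0 x - len g \<le> dist x0 (g \<triangleright> x)"
proof -
  show "dist x0 (g \<triangleright> x) \<le> len g + dist x0 x"
    using dist_triangle[of x0 "g \<triangleright> x" "pt g"] by simp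
  show "dist x0 x - len g \<le> dist x0 (g \<triangleright> x)"
    using dist_triangle[of "pt g" "g \<triangleright> x" x0] by (simp add: dist_commute[of "pt g"])
qed

lemma ip_app_le: "ip (g \<triangleright> x) (g \<triangleright> y) \<le> len g + ip x y"
  using dist_base_app(1)[of g x] dist_base_app(1)[of g y] dist_ip[of x y]
    dist_ip[of "g \<triangleright> x" "g \<triangleright> y"] dist_app[of g x y] by argo

lemma ip_app_ge: "ip x y - len g \<le> ip (g \<triangleright> x) (g \<triangleright> y)"
  using dist_base_app(2)[of x g] dist_base_app(2)[of y g] dist_ip[of x y]
    dist_ip[of "g \<triangleright> x" "g \<triangleright> y"] dist_app[of g x y] by argo

text \<open>Encodes the broken path \<open>x\<close>, \<open>x0\<close>, \<open>pt e1\<close>,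
  \<open>pt (e1 + e2)\<close> and so on. Each corner is translated to \<open>x0\<close>, where the
  previous vertex appears as \<open>pt (- e)\<close>; \<open>C\<close> bounds the corner products
  and \<open>D\<close> the legs after the first.\<close>

primrec chain :: "real \<Rightarrow> real \<Rightarrow> 'x \<Rightarrow> 'x isom list \<Rightarrow> bool" where
  "chain C D x [] \<longleftrightarrow> True"
| "chain C D x (e # es) \<longleftrightarrow> ip x (pt e) \<le> C \<and> D \<le> len e \<and> chain C D (pt (- e)) es"

definition lastp :: "'x \<Rightarrow> 'x isom list \<Rightarrow> 'x" where
  "lastp x es = (if es = [] then x else pt (- last es))"

lemma chain_append: "chain C D x (es @ fs) \<longleftrightarrow> chain C D x es \<and> chain C D (lastp x es) fs"
  by (induction es arbitrary: x) (auto simp: lastp_def)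

lemma chain_mono: "chain C D x es \<Longrightarrow> C \<le> C' \<Longrightarrow> chain C' D x es"
  by (induction es arbitrary: x) auto

text \<open>Local-to-global principle, by induction from the far end. At the next corner the rest of
  the path has product at most \<open>C + \<delta>\<close>, so its endpoint shares more than
  \<open>C + \<delta>\<close> with \<open>pt e\<close>; hyperbolicity then bounds its product with
  \<open>x\<close>. Errors do not accumulate, since every corner starts afresh from its own bound
  \<open>C\<close>.\<close>

lemma chain_product:
  assumes "chain C D x es" "0 \<le> C" "2 * C + 2 * \<delta> < D"
  shows "ip x (pt (sum_list es)) \<le> C + \<delta>"
    and "dist x x0 + real (length es) * (D - 2 * C - 2 * \<delta>) \<le> dist x (pt (sum_list es))"
proof -
  have "ip x (pt (sum_list es)) \<le> C + \<delta> \<and>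
    dist x x0 + real (length es) * (D - 2 * C - 2 * \<delta>) \<le> dist x (pt (sum_list es))"
    using assms(1)
  proof (induction es arbitrary: x)
    case Nil
    then show ?case using assms(2) delta_nonneg by simp
  next
    case (Cons e es)
    define g where "g = sum_list es"
    have 1: "ip (pt (- e)) (pt g) \<le> C + \<delta>"
      and 2: "dist (pt (- e)) x0 + real (length es) * (D - 2 * C - 2 * \<delta>) \<le> dist (pt (- e)) (pt g)"
      using Cons.IH[of "pt (- e)"] Cons.prems by (auto simp: g_def)
    have e: "D \<le> len e" "ip x (pt e) \<le> C" using Cons.prems by auto
    have "ip (pt e) (pt (e + g)) = len e - ip (pt (- e)) (pt g)"
      using ip_translate[of e "pt g"] by simp
    then have big: "C + \<delta> < ip (pt e) (pt (e + g))"
      using 1 e assms(3) by simp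
    have "ip x (pt (e + g)) \<le> C + \<delta>"
      using ip_hyperbolic[of x "pt (e + g)" "pt e"] big e(2) ip_commute[of "pt e"]
      by (auto simp: min_def split: if_splits)
    moreover have "len (e + g) = dist (pt (- e)) (pt g)"
      using dist_app_left[of "- e" x0 "pt g"] by simp
    moreover have "dist (pt (- e)) x0 = len e" using len_uminus[of e] by (simp add: dist_commute)
    ultimately show ?case
      using 2 e dist_ip[of x "pt (e + g)"] by (simp add: g_def algebra_simps dist_commute[of x x0])
  qed
  then show "ip x (pt (sum_list es)) \<le> C + \<delta>"
    "dist x x0 + real (length es) * (D - 2 * C - 2 * \<delta>) \<le> dist x (pt (sum_list es))" by auto
qed

lemma chain_replicate:
  assumes "ip x (pt w) \<le> C" "ip (pt (- w)) (pt w) \<le> C" "D \<le> len w"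
  shows "chain C D x (replicate n w)"
  using assms by (induction n arbitrary: x) auto

text \<open>The powers of \<open>w\<close> form a chain whose corner bound is the product of
  \<open>pt (- w)\<close> and \<open>pt w\<close> itself.\<close>

lemma translation_length_ge:
  assumes "2 * ip (pt (- w)) (pt w) + 2 * \<delta> < len w"
  shows "len w - 2 * ip (pt (- w)) (pt w) - 2 * \<delta> \<le> translation_length x0 (app w)"
proof -
  define r where "r = len w - 2 * ip (pt (- w)) (pt w) - 2 * \<delta>"
  have "real n * r \<le> len (iter n w)" for n
    using chain_product(2)[OF chain_replicate[of x0 w "ip (pt (- w)) (pt w)" "len w" n]] assms
    by (simp add: ip_nonneg r_def)
  then have "\<forall>n\<ge>1. r \<le> len (iter n w) / real n"
    by (simp add: field_simps)
  then show ?thesis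
    using LIMSEQ_le_const[OF translation_length_limit(1)[of x0 w]] unfolding r_def by blast
qed

section \<open>Loxodromic isometries\<close>

text \<open>The distance between the orbit points of exponents \<open>- m\<close> and
  \<open>m\<close> is the length of the power \<open>2 * m\<close>. If alignment always failed, each
  doubling of the exponent would add at most \<open>E\<close>, so lengths would grow logarithmically
  in the exponent, against the positive translation length.\<close>

lemma loxodromic_power_aligned:
  assumes "loxodromic x0 (app g)" "0 \<le> E"
  shows "\<exists>m\<ge>1. 2 * ip (pt (- iter m g)) (pt (iter m g)) + E \<le> len (iter m g)"
proof (rule ccontr)
  assume "\<not> ?thesis"
  then have less: "len (iter m g) < 2 * ip (pt (- iter m g)) (pt (iter m g)) + E" if "m \<ge> 1" for m
    using that by force
  have double: "len (iter (2 * m) g) \<le> len (iter m g) + E" if "m \<ge> 1" for m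
  proof -
    have "len (iter (2 * m) g) = dist (pt (- iter m g)) (pt (iter m g))"
      using dist_app_left[of "- iter m g" x0 "pt (iter m g)"] iter_add[of m m g]
      by (simp add: mult_2)
    then show ?thesis using less[OF that] dist_ip[of "pt (- iter m g)" "pt (iter m g)"] by simp
  qed
  have "len (iter (2 ^ j) g) \<le> len g + real j * E" for j
  proof (induction j)
    case (Suc j)
    then show ?case using double[of "2 ^ j"] by (simp add: algebra_simps)
  qed simp
  then have bound: "2 ^ j * translation_length x0 (app g) \<le> len g + real j * E" for j
    using order_trans[OF translation_length_limit(2)[of "2 ^ j" x0 g]] by simp
  have "translation_length x0 (app g) \<le> len g * (1 / 2) ^ j + E * (real j / 2 ^ j)" for j
  proof -
    have "len g * (1 / 2) ^ j + E * (real j / 2 ^ j) = (len g + real j * E) / 2 ^ j"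
      by (simp add: power_one_over[of 2 j] add_divide_distrib)
    then show ?thesis
      using bound[of j]
      by (simp add: le_divide_eq mult.commute)
  qed
  moreover have "(\<lambda>j. len g * (1 / 2) ^ j + E * (real j / 2 ^ j)) \<longlonglongrightarrow> len g * 0 + E * 0"
    using lim_n_over_pown[of "2::real"]
    by (intro tendsto_intros LIMSEQ_power_zero) auto
  ultimately have "translation_length x0 (app g) \<le> 0"
    using LIMSEQ_le_const[of _ "len g * 0 + E * 0" "translation_length x0 (app g)"] by auto
  then show False using assms(1) by (simp add: loxodromic_def)
qed

text \<open>The orbit of \<open>a\<close> is a quasi-geodesic line through the basepoint.\<close>

definition axial :: "real \<Rightarrow> real \<Rightarrow> 'x isom \<Rightarrow> bool" where
  "axial c \<kappa> a \<longleftrightarrow> 0 < \<kappa> \<and> (\<forall>i j. ip (pt (- iter i a)) (pt (iter j a)) \<le> c) \<and>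
     (\<forall>n. real n * \<kappa> \<le> len (iter n a))"

lemma axial_uminus: "axial c \<kappa> a \<Longrightarrow> axial c \<kappa> (- a)"
  using len_uminus by (auto simp: axial_def iter_uminus ip_commute)

lemma axial_mono: "axial c \<kappa> a \<Longrightarrow> c \<le> c' \<Longrightarrow> axial c' \<kappa> a"
  unfolding axial_def by (meson order_trans)

text \<open>\<open>chain_product\<close> is applied to the backward orbit seen from
  \<open>pt a\<close>, then to the forward orbit seen from a point of the backward one. The second
  application starts with corner bound \<open>c + \<delta>\<close>; hence the slack
  \<open>4 * \<delta> + 1\<close>.\<close>

lemma loxodromic_power_axial:
  assumes "loxodromic x0 (app g)"
  shows "\<exists>m\<ge>1. \<exists>c \<kappa>. axial c \<kappa> (iter m g)"
proof -
  obtain m where m: "m \<ge> 1"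
    "2 * ip (pt (- iter m g)) (pt (iter m g)) + (4 * \<delta> + 1) \<le> len (iter m g)"
    using loxodromic_power_aligned[OF assms, of "4 * \<delta> + 1"] delta_nonneg by auto
  define a where "a = iter m g"
  define c where "c = ip (pt (- a)) (pt a)"
  have c: "0 \<le> c" "2 * c + 4 * \<delta> + 1 \<le> len a" using m by (auto simp: c_def a_def ip_nonneg)
  have neg: "ip (pt a) (pt (- iter i a)) \<le> c + \<delta>" for i
  proof -
    have "chain c (len a) (pt a) (replicate i (- a))"
      using len_uminus[of a] by (intro chain_replicate) (auto simp: c_def ip_commute)
    from chain_product(1)[OF this] show ?thesis using c delta_nonneg by (simp add: iter_uminus)
  qed
  have "ip (pt (- iter i a)) (pt (iter j a)) \<le> c + 2 * \<delta>" for i j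
  proof -
    have "chain (c + \<delta>) (len a) (pt (- iter i a)) (replicate j a)"
      using neg[of i] delta_nonneg by (intro chain_replicate) (auto simp: c_def ip_commute)
    from chain_product(1)[OF this] show ?thesis using c delta_nonneg by simp
  qed
  moreover have "real n * 1 \<le> len (iter n a)" for n
  proof -
    have "real n * 1 \<le> real n * (len a - 2 * c - 2 * \<delta>)"
      using c delta_nonneg by (intro mult_left_mono) auto
    also have "\<dots> \<le> len (iter n a)"
      using chain_product(2)[OF chain_replicate[of x0 a c "len a" n]] c delta_nonneg
      by (simp add: c_def)
    finally show ?thesis .
  qed
  ultimately have "axial (c + 2 * \<delta>) 1 a" by (simp add: axial_def)
  then show ?thesis using m(1) unfolding a_def by blast
qed

lemma axial_ip:
  assumes "axial c \<kappa> a" "i \<le> n"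
  shows "len (iter i a) - c \<le> ip (pt (iter i a)) (pt (iter n a))"
proof -
  have "iter n a = iter i a + iter (n - i) a"
    using iter_add[of i "n - i" a] assms(2) by simp
  then show ?thesis
    using ip_translate[of "iter i a" "pt (iter (n - i) a)"] assms(1) by (simp add: axial_def)
qed

section \<open>Fixed points on the boundary\<close>

lemma gromov_sequence_iff:
  "gromov_sequence x0 u \<longleftrightarrow> (\<forall>Z. \<exists>N. \<forall>m\<ge>N. \<forall>n\<ge>N. Z \<le> ip (u m) (u n))"
  unfolding gromov_sequence_def filterlim_at_top eventually_prod_sequentially
  by (auto; metis ip_commute)

lemma at_top_iff:
  fixes f :: "nat \<Rightarrow> real"
  shows "filterlim f at_top sequentially \<longleftrightarrow> (\<forall>Z. \<exists>N. \<forall>n\<ge>N. Z \<le> f n)"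
  by (auto simp: filterlim_at_top eventually_sequentially)

lemma axial_gromov_sequence:
  assumes "axial c \<kappa> a"
  shows "gromov_sequence x0 (\<lambda>n. pt (iter n a))"
  unfolding gromov_sequence_iff
proof
  fix Z
  have \<kappa>: "0 < \<kappa>" using assms by (simp add: axial_def)
  obtain N :: nat where "(Z + c) / \<kappa> < N" using reals_Archimedean2 by blast
  then have N: "Z + c < real N * \<kappa>" using \<kappa> by (simp add: field_simps)
  have le: "Z \<le> ip (pt (iter m a)) (pt (iter n a))" if "N \<le> m" "m \<le> n" for m n
  proof -
    have "real N * \<kappa> \<le> real m * \<kappa>" using that \<kappa> by simp
    also have "\<dots> \<le> len (iter m a)" using assms by (simp add: axial_def)
    finally show ?thesis using axial_ip[OF assms that(2)] N by simp
  qed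
  have "Z \<le> ip (pt (iter m a)) (pt (iter n a))" if "N \<le> m" "N \<le> n" for m n
    using le[of m n] le[of n m] that ip_commute by (cases "m \<le> n") auto
  then show "\<exists>N. \<forall>m\<ge>N. \<forall>n\<ge>N. Z \<le> ip (pt (iter m a)) (pt (iter n a))" by blast
qed

lemma ip_at_top_trans:
  assumes "filterlim (\<lambda>n. ip (u n) (v n)) at_top sequentially"
    and "filterlim (\<lambda>n. ip (v n) (w n)) at_top sequentially"
  shows "filterlim (\<lambda>n. ip (u n) (w n)) at_top sequentially"
  unfolding at_top_iff
proof
  fix Z
  obtain N1 N2 where "\<forall>n\<ge>N1. Z + \<delta> \<le> ip (u n) (v n)" "\<forall>n\<ge>N2. Z + \<delta> \<le> ip (v n) (w n)"
    using assms unfolding at_top_iff by metis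
  then have "Z \<le> ip (u n) (w n)" if "n \<ge> max N1 N2" for n
    using that ip_hyperbolic[of "u n" "v n" "w n"] by (force simp: min_def split: if_splits)
  then show "\<exists>N. \<forall>n\<ge>N. Z \<le> ip (u n) (w n)" by blast
qed

lemma ip_at_top_app:
  assumes "filterlim (\<lambda>n. ip (u n) (v n)) at_top sequentially"
  shows "filterlim (\<lambda>n. ip (k \<triangleright> u n) (k \<triangleright> v n)) at_top sequentially"
  unfolding at_top_iff
proof
  fix Z
  obtain N where N: "\<forall>n\<ge>N. Z + len k \<le> ip (u n) (v n)"
    using assms unfolding at_top_iff by blast
  have "Z \<le> ip (k \<triangleright> u n) (k \<triangleright> v n)" if "n \<ge> N" for n
    using N that ip_app_ge[of "u n" "v n" k] by fastforce
  then show "\<exists>N. \<forall>n\<ge>N. Z \<le> ip (k \<triangleright> u n) (k \<triangleright> v n)" by blast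
qed

lemma gromov_sequence_app:
  assumes "gromov_sequence x0 u"
  shows "gromov_sequence x0 (app k \<circ> u)"
  unfolding gromov_sequence_iff
proof
  fix Z
  obtain N where N: "\<forall>m\<ge>N. \<forall>n\<ge>N. Z + len k \<le> ip (u m) (u n)"
    using assms unfolding gromov_sequence_iff by blast
  have "Z \<le> ip ((app k \<circ> u) m) ((app k \<circ> u) n)" if "m \<ge> N" "n \<ge> N" for m n
    using N that ip_app_ge[of "u m" "u n" k] by fastforce
  then show "\<exists>N. \<forall>m\<ge>N. \<forall>n\<ge>N. Z \<le> ip ((app k \<circ> u) m) ((app k \<circ> u) n)" by blast
qed

text \<open>The sequences \<open>v\<close>, \<open>v'\<close>, \<open>k v'\<close>,
  \<open>k v\<close>, \<open>k u\<close> are successively equivalent; the second equivalence holds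
  because \<open>k\<close> displaces \<open>v'\<close> by a bounded amount.\<close>

lemma boundary_class_app:
  assumes vv': "filterlim (\<lambda>n. ip (v n) (v' n)) at_top sequentially"
    and k: "\<And>n. dist (v' n) (k \<triangleright> v' n) \<le> r"
    and u: "(v, u) \<in> gromov_rel x0"
  shows "(v, app k \<circ> u) \<in> gromov_rel x0"
proof -
  have v'k: "filterlim (\<lambda>n. ip (v' n) (k \<triangleright> v' n)) at_top sequentially"
    unfolding at_top_iff
  proof
    fix Z
    obtain N where N: "\<forall>n\<ge>N. Z + r \<le> ip (v n) (v' n)"
      using vv' unfolding at_top_iff by blast
    have "Z \<le> ip (v' n) (k \<triangleright> v' n)" if "n \<ge> N" for n
    proof -
      have "Z + r \<le> dist x0 (v' n)" using N that ip_le_right[of "v n" "v' n"] by fastforce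
      then show ?thesis using ip_ge[of "v' n" "k \<triangleright> v' n"] k[of n] by linarith
    qed
    then show "\<exists>N. \<forall>n\<ge>N. Z \<le> ip (v' n) (k \<triangleright> v' n)" by blast
  qed
  have "filterlim (\<lambda>n. ip (k \<triangleright> v' n) (k \<triangleright> v n)) at_top sequentially"
    using ip_at_top_app[OF vv', of k] by (simp only: ip_commute)
  then have "filterlim (\<lambda>n. ip (v n) (k \<triangleright> v n)) at_top sequentially"
    by (rule ip_at_top_trans[OF ip_at_top_trans[OF vv' v'k]])
  moreover have "filterlim (\<lambda>n. ip (k \<triangleright> v n) (k \<triangleright> u n)) at_top sequentially"
    using ip_at_top_app u by (simp add: gromov_rel_def)
  ultimately have "filterlim (\<lambda>n. ip (v n) (k \<triangleright> u n)) at_top sequentially"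
    by (rule ip_at_top_trans)
  then show ?thesis using u gromov_sequence_app by (auto simp: gromov_rel_def)
qed

text \<open>The bounded displacement is asked of an equivalent sequence \<open>v'\<close> only.
  Taking for it an orbit of the other loxodromic element shows that equivalent orbits would give a
  common fixed point. Equality of sets comes from using both \<open>k\<close> and
  \<open>- k\<close>.\<close>

lemma boundary_class_fixed:
  assumes "gromov_sequence x0 v"
    and vv': "filterlim (\<lambda>n. ip (v n) (v' n)) at_top sequentially"
    and k: "\<And>n. dist (v' n) (k \<triangleright> v' n) \<le> r"
  shows "gromov_rel x0 `` {v} \<in> boundary_fixed_points x0 (app k)"
proof -
  have k': "dist (v' n) (- k \<triangleright> v' n) \<le> r" for n
    using k[of n] dist_app_left[of k "v' n" "v' n"] by (simp add: dist_commute)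
  have "boundary_map (app k) (gromov_rel x0 `` {v}) = gromov_rel x0 `` {v}"
    unfolding boundary_map_def
  proof (intro equalityI subsetI)
    fix u assume "u \<in> gromov_rel x0 `` {v}"
    then have "app (- k) \<circ> u \<in> gromov_rel x0 `` {v}" using boundary_class_app[OF vv' k'] by auto
    moreover have "u = app k \<circ> (app (- k) \<circ> u)" by auto
    ultimately show "u \<in> (\<circ>) (app k) ` gromov_rel x0 `` {v}" by blast
  qed (use boundary_class_app[OF vv' k] in auto)
  moreover have "gromov_rel x0 `` {v} \<in> gromov_boundary x0"
    using assms(1) unfolding gromov_boundary_def by (intro quotientI) simp
  ultimately show ?thesis by (simp add: boundary_fixed_points_def)
qed

text \<open>Disjoint fixed points prevent the diagonal products from tending to infinity, so they
  stay below some \<open>T\<close> for arbitrarily large \<open>n\<close>. Along each orbit the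
  products are almost maximal, and hyperbolicity carries the bound from such an \<open>n\<close> to
  all earlier \<open>i\<close> and \<open>j\<close>.\<close>

lemma axial_ip_bounded:
  assumes a: "axial c \<kappa> a" and b: "axial c \<kappa>' b"
    and g: "\<And>n. dist (pt (iter n a)) (g \<triangleright> pt (iter n a)) \<le> r"
    and h: "\<And>n. dist (pt (iter n b)) (h \<triangleright> pt (iter n b)) \<le> r'"
    and disj: "boundary_fixed_points x0 (app g) \<inter> boundary_fixed_points x0 (app h) = {}"
  shows "\<exists>T. \<forall>i j. ip (pt (iter i a)) (pt (iter j b)) \<le> T"
proof -
  define v where "v n = pt (iter n a)" for n
  define v' where "v' n = pt (iter n b)" for n
  have seq: "gromov_sequence x0 v" unfolding v_def using axial_gromov_sequence[OF a] .
  then have "filterlim (\<lambda>n. ip (v n) (v n)) at_top sequentially"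
    unfolding gromov_sequence_iff at_top_iff by blast
  then have "gromov_rel x0 `` {v} \<in> boundary_fixed_points x0 (app g)"
    using boundary_class_fixed[OF seq, of v g r] g by (simp add: v_def)
  then have "\<not> filterlim (\<lambda>n. ip (v n) (v' n)) at_top sequentially"
    using boundary_class_fixed[OF seq, of v' h r'] h disj by (auto simp: v'_def)
  then obtain T where T: "\<And>N. \<exists>n\<ge>N. ip (v n) (v' n) < T"
    unfolding at_top_iff by (meson not_le)
  have "ip (v i) (v' j) \<le> T + 2 * \<delta> + c" for i j
  proof -
    obtain n where n: "n \<ge> max i j" "ip (v n) (v' n) < T" using T by blast
    have 1: "dist x0 (v i) - c \<le> ip (v n) (v i)"
      using axial_ip[OF a, of i n] n ip_commute by (simp add: v_def)
    have 2: "dist x0 (v' j) - c \<le> ip (v' j) (v' n)"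
      using axial_ip[OF b, of j n] n by (simp add: v'_def)
    have "min (ip (v n) (v i)) (min (ip (v i) (v' j)) (ip (v' j) (v' n))) \<le> T + 2 * \<delta>"
      using ip_hyperbolic[of "v n" "v i" "v' n"] ip_hyperbolic[of "v i" "v' j" "v' n"] n(2)
        delta_nonneg by linarith
    moreover have "0 \<le> c" using a ip_nonneg unfolding axial_def by (meson order_trans)
    ultimately show ?thesis
      using 1 2 ip_le_left[of "v i" "v' j"] ip_le_right[of "v i" "v' j"] by linarith
  qed
  then show ?thesis unfolding v_def v'_def by blast
qed

section \<open>Schottky families\<close>

definition pingpong :: "real \<Rightarrow> 'x isom \<Rightarrow> 'x isom \<Rightarrow> bool" where
  "pingpong c a b \<longleftrightarrow>
     ip (pt (- a)) (pt a) \<le> c \<and> ip (pt (- b)) (pt b) \<le> c \<and> ip (pt a) (pt b) \<le> c \<and>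
     ip (pt (- a)) (pt (- b)) \<le> c \<and> ip (pt (- a)) (pt b) \<le> c \<and> ip (pt (- b)) (pt a) \<le> c"

lemma pingpong_uminus: "pingpong c a b \<Longrightarrow> pingpong c (- a) (- b)"
  by (simp add: pingpong_def ip_commute)

text \<open>The constant \<open>c\<close> is uniform in the exponents while the lengths grow
  linearly, so exponents can be chosen after \<open>c\<close>.\<close>

lemma pingpong_powers:
  assumes "loxodromic x0 (app g)" "loxodromic x0 (app h)"
    and disj: "boundary_fixed_points x0 (app g) \<inter> boundary_fixed_points x0 (app h) = {}"
  shows "\<exists>m\<ge>1. \<exists>m'\<ge>1. \<exists>c \<kappa>. 0 < \<kappa> \<and>
    (\<forall>i j. pingpong c (iter (i * m) g) (iter (j * m') h)) \<and>
    (\<forall>n. real n * \<kappa> \<le> len (iter (n * m) g) \<and> real n * \<kappa> \<le> len (iter (n * m') h))"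
proof -
  obtain m c1 \<kappa>1 where m: "m \<ge> 1" "axial c1 \<kappa>1 (iter m g)"
    using loxodromic_power_axial[OF assms(1)] by blast
  obtain m' c2 \<kappa>2 where m': "m' \<ge> 1" "axial c2 \<kappa>2 (iter m' h)"
    using loxodromic_power_axial[OF assms(2)] by blast
  define a where "a = iter m g"
  define b where "b = iter m' h"
  define c where "c = max c1 c2"
  have a: "axial c \<kappa>1 a" and b: "axial c \<kappa>2 b"
    using m m' axial_mono by (auto simp: a_def b_def c_def)
  \<comment> \<open>An isometry commutes with its powers, so it displaces all their orbit points by
    the same amount.\<close>
  have move: "dist (pt (iter n (iter m f))) (f \<triangleright> pt (iter n (iter m f))) \<le> len f" for n m f
  proof -
    have "f + iter (n * m) f = iter (n * m) f + f"
      using iter_Suc_right[of "n * m" f] by simp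
    then have "f \<triangleright> pt (iter (n * m) f) = iter (n * m) f \<triangleright> pt f" by (metis app_plus)
    then show ?thesis by (simp flip: iter_mult)
  qed
  have move': "dist (pt (iter n (- iter m f))) (f \<triangleright> pt (iter n (- iter m f))) \<le> len f" for n m f
  proof -
    have "dist (pt (iter n (- iter m f))) (- f \<triangleright> pt (iter n (- iter m f))) \<le> len f"
      using move[of n m "- f"] by (simp add: iter_uminus)
    then show ?thesis
      using dist_app_left[of f "pt (iter n (- iter m f))" "pt (iter n (- iter m f))"]
      by (simp add: dist_commute)
  qed
  note bounded = axial_ip_bounded[OF _ _ _ _ disj, of c _ _ _ _ "len g" "len h"]
  obtain T1 where T1: "\<And>i j. ip (pt (iter i a)) (pt (iter j b)) \<le> T1"
    using bounded[OF a b] move move' unfolding a_def b_def by blast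
  obtain T2 where T2: "\<And>i j. ip (pt (iter i (- a))) (pt (iter j b)) \<le> T2"
    using bounded[OF axial_uminus[OF a] b] move move' unfolding a_def b_def by blast
  obtain T3 where T3: "\<And>i j. ip (pt (iter i a)) (pt (iter j (- b))) \<le> T3"
    using bounded[OF a axial_uminus[OF b]] move move' unfolding a_def b_def by blast
  obtain T4 where T4: "\<And>i j. ip (pt (iter i (- a))) (pt (iter j (- b))) \<le> T4"
    using bounded[OF axial_uminus[OF a] axial_uminus[OF b]] move move' unfolding a_def b_def by blast
  define C where "C = max c (max T1 (max T2 (max T3 T4)))"
  have C: "c \<le> C" "T1 \<le> C" "T2 \<le> C" "T3 \<le> C" "T4 \<le> C" by (auto simp: C_def)
  have "pingpong C (iter i a) (iter j b)" for i j
  proof -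
    have "ip (pt (- iter i a)) (pt (iter i a)) \<le> c" "ip (pt (- iter j b)) (pt (iter j b)) \<le> c"
      using a b unfolding axial_def by blast+
    moreover have "ip (pt (- iter j b)) (pt (iter i a)) \<le> T3"
      using T3[of i j] ip_commute by (simp add: iter_uminus)
    ultimately show ?thesis
      using T1[of i j] T2[of i j] T4[of i j] C unfolding pingpong_def iter_uminus by linarith
  qed
  moreover have "real n * min \<kappa>1 \<kappa>2 \<le> len (iter n a)" "real n * min \<kappa>1 \<kappa>2 \<le> len (iter n b)" for n
  proof -
    have "real n * min \<kappa>1 \<kappa>2 \<le> real n * \<kappa>1" "real n * min \<kappa>1 \<kappa>2 \<le> real n * \<kappa>2"
      by (auto intro: mult_left_mono)
    moreover have "real n * \<kappa>1 \<le> len (iter n a)" "real n * \<kappa>2 \<le> len (iter n b)"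
      using a b by (auto simp: axial_def)
    ultimately show "real n * min \<kappa>1 \<kappa>2 \<le> len (iter n a)" "real n * min \<kappa>1 \<kappa>2 \<le> len (iter n b)"
      by linarith+
  qed
  moreover have "0 < min \<kappa>1 \<kappa>2" using a b by (simp add: axial_def)
  ultimately show ?thesis
    using m(1) m'(1) unfolding a_def b_def by (metis iter_mult)
qed

lemma pingpong_chain:
  assumes "pingpong c a b" "D \<le> len a" "D \<le> len b"
  shows "set es \<subseteq> {a, b} \<Longrightarrow> es \<noteq> [] \<Longrightarrow> ip x (pt (hd es)) \<le> c \<Longrightarrow> chain c D x es"
proof (induction es arbitrary: x)
  case (Cons e es)
  have "chain c D (pt (- e)) es"
  proof (cases "es = []")
    case False
    then have "hd es \<in> {a, b}" "e \<in> {a, b}" using Cons.prems(1) by (auto simp: neq_Nil_conv)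
    then have "ip (pt (- e)) (pt (hd es)) \<le> c" using assms(1) by (auto simp: pingpong_def)
    then show ?thesis using Cons False by auto
  qed simp
  then show ?case using Cons.prems assms by auto
qed simp

text \<open>The word beginning with \<open>b\<close> is a chain seen from \<open>pt a\<close>; the
  word beginning with \<open>a\<close> is then a chain seen from the end of the first word. Each
  view costs one \<delta>.\<close>

lemma pingpong_diverge:
  assumes pp: "pingpong c a b" and D: "2 * c + 4 * \<delta> < len a" "2 * c + 4 * \<delta> < len b"
    and es: "set es \<subseteq> {a, b}" "set fs \<subseteq> {a, b}"
  shows "ip (pt (sum_list (b # es))) (pt (sum_list (a # fs))) \<le> c + 2 * \<delta>"
proof -
  define D where "D = min (len a) (len b)"
  have D': "2 * c + 4 * \<delta> < D" "D \<le> len a" "D \<le> len b" using D by (auto simp: D_def)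
  have c: "0 \<le> c" using pp ip_nonneg unfolding pingpong_def by (meson order_trans)
  have "chain c D (pt a) (b # es)"
    using es pp by (intro pingpong_chain[OF pp D'(2,3)]) (auto simp: pingpong_def)
  from chain_product(1)[OF this c]
  have "ip (pt (sum_list (b # es))) (pt a) \<le> c + \<delta>"
    using D' delta_nonneg ip_commute by auto
  moreover have "chain c D (pt (- a)) fs"
  proof (cases "fs = []")
    case False
    then have "hd fs \<in> {a, b}" using es(2) hd_in_set by blast
    then show ?thesis
      using es pp False by (intro pingpong_chain[OF pp D'(2,3)]) (auto simp: pingpong_def)
  qed simp
  ultimately have "chain (c + \<delta>) D (pt (sum_list (b # es))) (a # fs)"
    using D' delta_nonneg chain_mono[of c D _ fs "c + \<delta>"] by simp
  from chain_product(1)[OF this] show ?thesis using D' c delta_nonneg by simp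
qed

section \<open>Palindromic words of equal length\<close>

lemma uminus_sum_list: "- sum_list es = sum_list (map uminus (rev es))" for es :: "'x isom list"
  by (induction es) (simp_all add: minus_add)

text \<open>The palindromes \<open>a\<^sup>i b a\<^bsup>L-2i\<^esup> b a\<^sup>i\<close> and their inverses diverge from each other after
  at most \<open>i\<close> letters.\<close>

definition palindrome :: "'x isom \<Rightarrow> 'x isom \<Rightarrow> nat \<Rightarrow> nat \<Rightarrow> 'x isom list" where
  "palindrome a b L i = replicate i a @ [b] @ replicate (L - 2 * i) a @ [b] @ replicate i a"

lemma length_palindrome: "2 * i \<le> L \<Longrightarrow> length (palindrome a b L i) = L + 2"
  by (simp add: palindrome_def)

lemma set_palindrome: "set (palindrome a b L i) \<subseteq> {a, b}"
  by (auto simp: palindrome_def)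

text \<open>The reason for palindromes: inverses have the same shape in \<open>- a\<close> and
  \<open>- b\<close>, so one divergence estimate serves both conditions of a Schottky
  family.\<close>

lemma uminus_palindrome: "- sum_list (palindrome a b L i) = sum_list (palindrome (- a) (- b) L i)"
  unfolding uminus_sum_list palindrome_def by simp

text \<open>Only the common prefix, a power of \<open>a\<close>, costs anything. The bound does not
  involve \<open>L\<close>, which can therefore be chosen afterwards to make the words long compared
  with it.\<close>

lemma palindrome_diverge:
  assumes pp: "pingpong c a b" and D: "2 * c + 4 * \<delta> < len a" "2 * c + 4 * \<delta> < len b"
    and "i < j" "j < N"
  shows "ip (pt (sum_list (palindrome a b L i))) (pt (sum_list (palindrome a b L j)))
    \<le> real N * len a + c + 2 * \<delta>"
proof -
  have j: "replicate j a = replicate i a @ a # replicate (j - i - 1) a"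
    using assms(4) by (simp flip: replicate_Suc replicate_add)
  obtain es where es: "palindrome a b L i = replicate i a @ b # es" "set es \<subseteq> {a, b}"
    by (rule that[of "replicate (L - 2 * i) a @ [b] @ replicate i a"])
      (auto simp: palindrome_def set_replicate_conv_if)
  obtain fs where fs: "palindrome a b L j = replicate i a @ a # fs" "set fs \<subseteq> {a, b}"
    by (rule that[of "replicate (j - i - 1) a @ [b] @ replicate (L - 2 * j) a @ [b] @ replicate j a"])
      (auto simp: palindrome_def j set_replicate_conv_if)
  have "len (iter n a) \<le> real n * len a" for n
  proof (induction n)
    case (Suc n)
    then show ?case using len_plus[of a "iter n a"] by (simp add: algebra_simps)
  qed simp
  then have "len (iter i a) \<le> real i * len a" .
  also have "\<dots> \<le> real N * len a" using assms(4,5) by (intro mult_right_mono) auto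
  finally have "len (iter i a) \<le> real N * len a" .
  then show ?thesis
    using ip_app_le[of "iter i a" "pt (sum_list (b # es))" "pt (sum_list (a # fs))"]
      pingpong_diverge[OF pp D es(2) fs(2)] by (simp add: es(1) fs(1))
qed

text \<open>Cancellation at a corner with product at most \<open>C\<close> removes at most
  \<open>2 * C\<close>, and \<open>4 * C + 2 * \<delta> + 1\<close> then leaves a leg long enough
  for a chain. The point \<open>y\<close> stands for an arbitrary continuation after the
  letter.\<close>

definition schottky :: "real \<Rightarrow> nat \<Rightarrow> (nat \<Rightarrow> 'x isom) \<Rightarrow> bool" where
  "schottky C N \<sigma> \<longleftrightarrow> 0 \<le> C \<and> (\<forall>i<N. 4 * C + 2 * \<delta> + 1 \<le> len (\<sigma> i)) \<and>
     (\<forall>x y. card {i. i < N \<and> C < ip x (\<sigma> i \<triangleright> y)} \<le> 2) \<and>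
     (\<forall>y. card {i. i < N \<and> C < ip (pt (- \<sigma> i)) y} \<le> 1)"

text \<open>A point has a large product with at most one of several pairwise divergent points. If
  \<open>x\<close> shares much with \<open>\<sigma> i \<triangleright> y\<close>, then either
  \<open>y\<close> points towards \<open>pt (- \<sigma> i)\<close>, or \<open>x\<close> points
  towards \<open>pt (\<sigma> i)\<close>; each happens for at most one \<open>i\<close>.\<close>

lemma schottkyI:
  assumes C: "0 \<le> C" and len: "\<And>i. i < N \<Longrightarrow> 4 * (C + 2 * \<delta>) + 2 * \<delta> + 1 \<le> len (\<sigma> i)"
    and ip1: "\<And>i j. i < j \<Longrightarrow> j < N \<Longrightarrow> ip (pt (\<sigma> i)) (pt (\<sigma> j)) \<le> C"
    and ip2: "\<And>i j. i < j \<Longrightarrow> j < N \<Longrightarrow> ip (pt (- \<sigma> i)) (pt (- \<sigma> j)) \<le> C"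
  shows "schottky (C + 2 * \<delta>) N \<sigma>"
proof -
  have unique: "card {i. i < N \<and> C + \<delta> < ip (u i) y} \<le> 1"
    if u: "\<And>i j. i < j \<Longrightarrow> j < N \<Longrightarrow> ip (u i) (u j) \<le> C" for u y
  proof -
    have "i = j" if "i < N" "j < N" "C + \<delta> < ip (u i) y" "C + \<delta> < ip (u j) y" for i j
    proof (rule ccontr)
      assume "i \<noteq> j"
      then have "ip (u i) (u j) \<le> C" using u[of i j] u[of j i] that by (metis ip_commute nat_neq_iff)
      then show False using ip_hyperbolic[of "u i" y "u j"] that ip_commute[of y] by auto
    qed
    then have "card {i. i < N \<and> C + \<delta> < ip (u i) y} \<le> Suc 0"
      by (subst card_le_Suc0_iff_eq) auto
    then show ?thesis by simp
  qed
  have "card {i. i < N \<and> C + 2 * \<delta> < ip (pt (- \<sigma> i)) y} \<le> 1" for y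
    using unique[of "\<lambda>i. pt (- \<sigma> i)" y, OF ip2] delta_nonneg
    by (intro order_trans[OF card_mono unique[of "\<lambda>i. pt (- \<sigma> i)" y, OF ip2]]) auto
  moreover have "card {i. i < N \<and> C + 2 * \<delta> < ip x (\<sigma> i \<triangleright> y)} \<le> 2" for x y
  proof -
    have "{i. i < N \<and> C + 2 * \<delta> < ip x (\<sigma> i \<triangleright> y)} \<subseteq>
      {i. i < N \<and> C + \<delta> < ip (pt (- \<sigma> i)) y} \<union> {i. i < N \<and> C + \<delta> < ip (pt (\<sigma> i)) x}"
    proof (clarsimp)
      fix i assume i: "i < N" "C + 2 * \<delta> < ip x (\<sigma> i \<triangleright> y)" "\<not> C + \<delta> < ip (pt (\<sigma> i)) x"
      show "C + \<delta> < ip (- \<sigma> i \<triangleright> x0) y"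
      proof (rule ccontr)
        assume "\<not> ?thesis"
        then have "C + 2 * \<delta> < ip (\<sigma> i \<triangleright> y) (pt (\<sigma> i))"
          using ip_translate[of "\<sigma> i" y] len[OF i(1)] C delta_nonneg ip_commute by auto
        then show False
          using ip_hyperbolic[of x "\<sigma> i \<triangleright> y" "pt (\<sigma> i)"] i ip_commute by auto
      qed
    qed
    then have "card {i. i < N \<and> C + 2 * \<delta> < ip x (\<sigma> i \<triangleright> y)} \<le>
      card ({i. i < N \<and> C + \<delta> < ip (pt (- \<sigma> i)) y} \<union> {i. i < N \<and> C + \<delta> < ip (pt (\<sigma> i)) x})"
      by (intro card_mono) auto
    also have "\<dots> \<le> 1 + 1"
      using unique[of "\<lambda>i. pt (- \<sigma> i)" y, OF ip2] unique[of "\<lambda>i. pt (\<sigma> i)" x, OF ip1]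
      by (intro order_trans[OF card_Un_le add_mono]) auto
    finally show ?thesis by simp
  qed
  ultimately show ?thesis using C delta_nonneg len by (auto simp: schottky_def)
qed

text \<open>\<open>W n\<close> stands for the elements spelled by \<open>n\<close> steps. All
  letters must lie in the same \<open>W M\<close>, since the walk has to produce any of them in the
  same number of steps.\<close>

lemma schottky_exists:
  fixes W :: "nat \<Rightarrow> 'x isom set"
  assumes lox: "loxodromic x0 (app g)" "loxodromic x0 (app h)"
    and disj: "boundary_fixed_points x0 (app g) \<inter> boundary_fixed_points x0 (app h) = {}"
    and W: "\<And>m n x y. x \<in> W m \<Longrightarrow> y \<in> W n \<Longrightarrow> x + y \<in> W (m + n)"
    and g: "g \<in> W p" "1 \<le> p" and h: "h \<in> W q" "1 \<le> q"
  shows "\<exists>C \<sigma> M. schottky C N \<sigma> \<and> 1 \<le> M \<and> (\<forall>i<N. \<sigma> i \<in> W M)"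
proof -
  obtain m m' c \<kappa> where mm: "m \<ge> 1" "m' \<ge> 1" "0 < \<kappa>"
    and pp: "\<And>i j. pingpong c (iter (i * m) g) (iter (j * m') h)"
    and grow: "\<And>n. real n * \<kappa> \<le> len (iter (n * m) g)" "\<And>n. real n * \<kappa> \<le> len (iter (n * m') h)"
    using pingpong_powers[OF lox disj] by blast
  have c: "0 \<le> c" using pp ip_nonneg unfolding pingpong_def by (meson order_trans)
  obtain n :: nat where "(2 * c + 4 * \<delta> + 1) / \<kappa> < n" using reals_Archimedean2 by blast
  then have n: "2 * c + 4 * \<delta> + 1 < real n * \<kappa>" using mm by (simp add: field_simps)
  have n1: "n \<ge> 1" using n c delta_nonneg by (cases n) auto
  \<comment> \<open>These exponents give \<open>a\<close> and \<open>b\<close> the same word length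
    \<open>K\<close>; both are at least \<open>n\<close>, which puts the lengths above the ping-pong
    threshold.\<close>
  define i where "i = n * (m' * q)"
  define j where "j = n * (m * p)"
  define a where "a = iter (i * m) g"
  define b where "b = iter (j * m') h"
  define K where "K = i * m * p"
  have K: "K = j * m' * q" by (simp add: K_def i_def j_def mult_ac)
  have K1: "1 \<le> K" using n1 mm g h by (simp add: K_def i_def)
  have ij: "n \<le> i" "n \<le> j" using mm g h by (auto simp: i_def j_def)
  have "real n * \<kappa> \<le> real i * \<kappa>" "real n * \<kappa> \<le> real j * \<kappa>"
    using ij mm by (auto intro: mult_right_mono)
  then have D: "2 * c + 4 * \<delta> + 1 < len a" "2 * c + 4 * \<delta> + 1 < len b"
    using n grow(1)[of i] grow(2)[of j] by (auto simp: a_def b_def)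
  have ppab: "pingpong c a b" using pp by (simp add: a_def b_def)
  have list_W: "sum_list es \<in> W (length es * k)" if "es \<noteq> []" "set es \<subseteq> W k" for es k
    using that
  proof (induction es)
    case (Cons e es)
    then show ?case using W[of e k "sum_list es" "length es * k"] by (cases "es = []") auto
  qed simp
  have a: "a \<in> W K" using list_W[of "replicate (i * m) g" p] g ij n1 mm by (simp add: a_def K_def)
  have b: "b \<in> W K" using list_W[of "replicate (j * m') h" q] h ij n1 mm by (simp add: b_def K)
  define C where "C = real N * len a + c + 2 * \<delta>"
  have C: "0 \<le> C" using c delta_nonneg by (simp add: C_def)
  obtain L0 :: nat where L0: "4 * (C + 2 * \<delta>) + 2 * \<delta> + 1 < L0" using reals_Archimedean2 by blast
  \<comment> \<open>\<open>L0\<close> makes the letters long relative to \<open>C\<close>;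
    \<open>2 * N\<close> makes \<open>L - 2 * i\<close> a true difference, so that all words have
    length \<open>L + 2\<close>.\<close>
  define L where "L = max L0 (2 * N)"
  define \<sigma> where "\<sigma> i = sum_list (palindrome a b L i)" for i
  have L: "2 * i \<le> L" if "i < N" for i using that by (simp add: L_def)
  have "schottky (C + 2 * \<delta>) N \<sigma>"
  proof (rule schottkyI[OF C])
    fix i assume i: "i < N"
    define D where "D = min (len a) (len b)"
    have D': "2 * c + 4 * \<delta> + 1 < D" "D \<le> len a" "D \<le> len b" using D by (auto simp: D_def)
    have "palindrome a b L i \<noteq> []" by (simp add: palindrome_def)
    then have "chain c D x0 (palindrome a b L i)"
      using set_palindrome c by (intro pingpong_chain[OF ppab D'(2,3)]) auto
    from chain_product(2)[OF this c]
    have grow: "real (L + 2) * (D - 2 * c - 2 * \<delta>) \<le> len (\<sigma> i)"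
      using D' delta_nonneg by (simp add: length_palindrome[OF L[OF i]] \<sigma>_def)
    have "real L0 \<le> real (L + 2) * 1" by (simp add: L_def)
    also have "\<dots> \<le> real (L + 2) * (D - 2 * c - 2 * \<delta>)"
      using D' delta_nonneg by (intro mult_left_mono) auto
    also note grow
    finally show "4 * (C + 2 * \<delta>) + 2 * \<delta> + 1 \<le> len (\<sigma> i)" using L0 by simp
  next
    fix i j assume "i < j" "j < N"
    then show "ip (pt (\<sigma> i)) (pt (\<sigma> j)) \<le> C"
      using palindrome_diverge[OF ppab, of i j N] D by (simp add: \<sigma>_def C_def)
  next
    fix i j assume "i < j" "j < N"
    then show "ip (pt (- \<sigma> i)) (pt (- \<sigma> j)) \<le> C"
      using palindrome_diverge[OF pingpong_uminus[OF ppab], of i j N] D len_uminus[of a] len_uminus[of b]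
      by (simp add: \<sigma>_def C_def uminus_palindrome)
  qed
  moreover have "\<sigma> i \<in> W ((L + 2) * K)" if "i < N" for i
    using list_W[of "palindrome a b L i" K] set_palindrome[of a b L i] a b L[OF that]
    by (auto simp: length_palindrome \<sigma>_def palindrome_def)
  ultimately show ?thesis using K1 by (metis add_leD2 le_add2 le_trans mult_le_mono nat_mult_1 one_le_numeral)
qed

end

section \<open>Pivotal states\<close>

text \<open>A state describes the law of a random product: \<open>Base u fs\<close> is the fixed product of \<open>u\<close> and
  the segments \<open>fs\<close>; \<open>Push s A fs\<close> continues \<open>s\<close> by a letter \<open>\<sigma> i\<close> with \<open>i\<close> uniform in \<open>A\<close> (the
  pivot) and then by the fixed segments \<open>fs\<close>. Segments are not multiplied out, since every corner
  between them must satisfy the alignment bound with the same constant.\<close>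

datatype 'g pivot_state = Base 'g "'g list" | Push "'g pivot_state" "nat set" "'g list"

primrec base :: "'g pivot_state \<Rightarrow> 'g" where
  "base (Base u fs) = u"
| "base (Push s A fs) = base s"

primrec pivots :: "'g pivot_state \<Rightarrow> nat" where
  "pivots (Base u fs) = 0"
| "pivots (Push s A fs) = Suc (pivots s)"

primrec freeze :: "'g pivot_state \<Rightarrow> 'g \<Rightarrow> 'g pivot_state" where
  "freeze (Base u fs) e = Base u (fs @ [e])"
| "freeze (Push s A fs) e = Push s A (fs @ [e])"

lemma freeze_simps [simp]: "base (freeze s e) = base s" "pivots (freeze s e) = pivots s"
  by (cases s; simp)+

text \<open>\<open>z\<close> is an arbitrary viewpoint. The number 200 leaves room for the two
  comparisons below, \<open>24 \<le> card A\<close> with \<open>card A\<close> at least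
  \<open>N - 3\<close>, and \<open>128 \<le> N\<close>.\<close>

locale pivoting = four_point_space x0 \<delta> for x0 :: "'x::metric_space" and \<delta> :: real +
  fixes C :: real and N :: nat and \<sigma> :: "nat \<Rightarrow> 'x isom" and z :: 'x
  assumes schottky: "schottky C N \<sigma>" and N: "200 \<le> N"
begin

abbreviation D :: real where "D \<equiv> 2 * C + 2 * \<delta> + 1"

definition smax :: real where "smax = (\<Sum>i<N. len (\<sigma> i))"

lemma C_nonneg: "0 \<le> C"
  using schottky by (simp add: schottky_def)

lemma len_le_smax: "i < N \<Longrightarrow> len (\<sigma> i) \<le> smax"
  unfolding smax_def by (intro member_le_sum) auto

lemma smax_nonneg: "0 \<le> smax"
  unfolding smax_def by (intro sum_nonneg) auto

lemma len_sigma: "i < N \<Longrightarrow> 4 * C + 2 * \<delta> + 1 \<le> len (\<sigma> i)"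
  using schottky by (simp add: schottky_def)

lemma len_sigma_plus:
  assumes "i < N" "ip (pt (- \<sigma> i)) (pt h) \<le> C"
  shows "D \<le> len (\<sigma> i + h)"
  using assms len_sigma[of i] dist_app_left[of "- \<sigma> i" x0 "pt h"] len_uminus[of "\<sigma> i"]
    dist_ip[of "pt (- \<sigma> i)" "pt h"] ip_le_right[of "pt (- \<sigma> i)" "pt h"] C_nonneg by simp

lemma chain_product_D:
  assumes "chain C D x es"
  shows "ip x (pt (sum_list es)) \<le> C + \<delta>"
    and "dist x x0 + real (length es) \<le> dist x (pt (sum_list es))"
  using chain_product[OF assms C_nonneg] by auto

text \<open>A clean state has a nonempty list after each pivot, so the point that a continuation
  must be aligned with does not depend on the values of the pivots.\<close>

primrec last_point :: "'x isom pivot_state \<Rightarrow> 'x" where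
  "last_point (Base u fs) = lastp (- u \<triangleright> z) fs"
| "last_point (Push s A fs) = lastp x0 fs"

text \<open>The 3 is that of \<open>card_bad\<close>: at most two values of a pivot are unaligned on
  its left, and at most one on its right.\<close>

primrec clean :: "'x isom pivot_state \<Rightarrow> bool" where
  "clean (Base u fs) \<longleftrightarrow> chain C D (- u \<triangleright> z) fs"
| "clean (Push s A fs) \<longleftrightarrow> clean s \<and> fs \<noteq> [] \<and> A \<subseteq> {..<N} \<and> N \<le> card A + 3 \<and>
     (\<forall>i\<in>A. chain C D (last_point s) (\<sigma> i # fs))"

primrec average :: "'x isom pivot_state \<Rightarrow> ('x isom \<Rightarrow> real) \<Rightarrow> real" where
  "average (Base u fs) f = f (u + sum_list fs)"
| "average (Push s A fs) f = (\<Sum>i\<in>A. average s (\<lambda>g. f (g + (\<sigma> i + sum_list fs)))) / card A"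

text \<open>A length budget valid for all values of the pivots at once. It restricts the states that
  have to be considered and finally bounds \<open>base\<close>.\<close>

primrec extent :: "'x isom pivot_state \<Rightarrow> real" where
  "extent (Base u fs) = len u + len (sum_list fs)"
| "extent (Push s A fs) = extent s + smax + len (sum_list fs)"

lemma average_freeze: "average (freeze s e) f = average s (\<lambda>g. f (g + e))"
  by (cases s) (simp_all add: add.assoc)

lemma extent_freeze: "extent (freeze s e) \<le> extent s + len e"
proof (cases s)
  case (Base u fs)
  then show ?thesis using len_plus[of "sum_list fs" e] by simp
next
  case (Push t A fs)
  then show ?thesis using len_plus[of "sum_list fs" e] by simp
qed

lemma len_base_le: "len (base s) \<le> extent s"
proof (induction s)
  case (Push s A fs)
  then show ?case
    using add_nonneg_nonneg[OF smax_nonneg zero_le_dist[of x0 "pt (sum_list fs)"]]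
    by (simp add: add.assoc)
qed simp

lemma clean_freeze:
  assumes "clean s" "ip (last_point s) (pt e) \<le> C" "D \<le> len e"
  shows "clean (freeze s e)"
  using assms by (cases s) (auto simp: chain_append lastp_def)

lemma average_sum: "average s (\<lambda>g. \<Sum>i\<in>I. f i g) = (\<Sum>i\<in>I. average s (f i))"
proof (induction s arbitrary: f)
  case (Push s A fs)
  have "average (Push s A fs) (\<lambda>g. \<Sum>i\<in>I. f i g) =
    (\<Sum>j\<in>A. \<Sum>i\<in>I. average s (\<lambda>g. f i (g + (\<sigma> j + sum_list fs)))) / card A"
    by (simp add: Push)
  then show ?case by (subst (asm) sum.swap) (simp add: sum_divide_distrib)
qed simp

lemma average_cmult: "average s (\<lambda>g. c * f g) = c * average s f"
  by (induction s arbitrary: f) (simp_all flip: sum_distrib_left)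

lemma average_divide: "average s (\<lambda>g. f g / c) = average s f / c"
  using average_cmult[of s "1 / c" f] by simp

lemma card_pos: "clean (Push s A fs) \<Longrightarrow> 0 < card A"
  using N by auto

text \<open>The condition on \<open>lastp\<close> is what lets the induction attach the next pivot
  and its segments to the chain built so far.\<close>

lemma average_le:
  assumes "clean s"
    and "\<And>es. chain C D (- base s \<triangleright> z) es \<Longrightarrow> lastp (- base s \<triangleright> z) es = last_point s \<Longrightarrow>
      pivots s \<le> length es \<Longrightarrow> f (base s + sum_list es) \<le> c"
  shows "average s f \<le> c"
  using assms
proof (induction s arbitrary: f)
  case (Push s A fs)
  have "average s (\<lambda>g. f (g + (\<sigma> i + sum_list fs))) \<le> c" if i: "i \<in> A" for i
  proof (rule Push.IH)
    fix es assume es: "chain C D (- base s \<triangleright> z) es"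
      "lastp (- base s \<triangleright> z) es = last_point s" "pivots s \<le> length es"
    have "f (base (Push s A fs) + sum_list (es @ \<sigma> i # fs)) \<le> c"
    proof (rule Push.prems(2))
      show "chain C D (- base (Push s A fs) \<triangleright> z) (es @ \<sigma> i # fs)"
        using es Push.prems(1) i by (simp add: chain_append)
    qed (use es Push.prems(1) in \<open>auto simp: lastp_def\<close>)
    then show "f (base s + sum_list es + (\<sigma> i + sum_list fs)) \<le> c" by (simp add: add.assoc)
  qed (use Push.prems in auto)
  then have "(\<Sum>i\<in>A. average s (\<lambda>g. f (g + (\<sigma> i + sum_list fs)))) \<le> card A * c"
    by (rule sum_bounded_above)
  then show ?case using card_pos[OF Push.prems(1)] by (simp add: divide_le_eq mult.commute)
qed auto

text \<open>The states that can arise from \<open>s\<close> by multiplying with \<open>h\<close> and discarding pivots.\<close>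

definition derived :: "'x isom pivot_state \<Rightarrow> 'x isom \<Rightarrow> 'x isom pivot_state \<Rightarrow> bool" where
  "derived s h s' \<longleftrightarrow> extent s' \<le> extent s + len h \<and> (pivots s' = 0 \<or> base s' = base s)"

lemma card_bad:
  "card {i. i < N \<and> \<not> (ip x (\<sigma> i \<triangleright> y) \<le> C \<and> ip (pt (- \<sigma> i)) y' \<le> C)} \<le> 3"
proof -
  have "card {i. i < N \<and> \<not> (ip x (\<sigma> i \<triangleright> y) \<le> C \<and> ip (pt (- \<sigma> i)) y' \<le> C)} \<le>
    card ({i. i < N \<and> C < ip x (\<sigma> i \<triangleright> y)} \<union> {i. i < N \<and> C < ip (pt (- \<sigma> i)) y'})"
    by (intro card_mono) auto
  also have "\<dots> \<le> 2 + 1"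
    using schottky unfolding schottky_def by (intro order_trans[OF card_Un_le add_mono]) auto
  finally show ?thesis by simp
qed

text \<open>Given that the top pivot is unaligned with the new endpoint, conditioning on its value
  restores alignment except for three values of the pivot, so the number of discarded pivots has
  a geometric tail.\<close>

lemma average_plus_le:
  assumes "clean s" "0 \<le> \<beta>"
    and "\<And>s'. clean s' \<Longrightarrow> derived s h s' \<Longrightarrow> average s' f \<le> \<beta> / 4 ^ pivots s'"
  shows "average s (\<lambda>g. f (g + h)) \<le> 8 * \<beta> / 4 ^ pivots s"
  using assms(1,3)
proof (induction s arbitrary: h)
  case (Base u fs)
  have "derived (Base u fs) h (Base (u + sum_list fs + h) [])"
    using len_plus[of "u + sum_list fs" h] len_plus[of u "sum_list fs"] by (simp add: derived_def)
  then have "f (u + sum_list fs + h) \<le> \<beta>"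
    using Base.prems(2)[of "Base (u + sum_list fs + h) []"] by simp
  then show ?case using assms(2) by simp
next
  case (Push s A fs)
  define b where "b = \<beta> / 4 ^ pivots s"
  define h' where "h' = sum_list fs + h"
  define F where "F i = average s (\<lambda>g. f (g + (\<sigma> i + h')))" for i
  define good where "good i \<longleftrightarrow> ip (last_point s) (\<sigma> i \<triangleright> pt h') \<le> C \<and> ip (pt (- \<sigma> i)) (pt h') \<le> C" for i
  have A: "A \<subseteq> {..<N}" "N \<le> card A + 3" "finite A" "clean s"
    using Push.prems(1) by (auto intro: finite_subset)
  have b: "0 \<le> b" using assms(2) by (simp add: b_def)
  have lh: "len (\<sigma> i + h') \<le> smax + len (sum_list fs) + len h" if "i \<in> A" for i
    using len_plus[of "\<sigma> i" h'] len_plus[of "sum_list fs" h] len_le_smax[of i] A that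
    by (auto simp: h'_def)
  \<comment> \<open>Fixing an aligned top pivot costs exactly this one pivot, hence the bound
    \<open>b\<close> with exponent \<open>pivots s\<close>.\<close>
  have good: "F i \<le> b" if "i \<in> A" "good i" for i
  proof -
    have "clean (freeze s (\<sigma> i + h'))"
      using that A len_sigma_plus[of i h'] by (intro clean_freeze) (auto simp: good_def)
    moreover have "derived (Push s A fs) h (freeze s (\<sigma> i + h'))"
      using extent_freeze[of s "\<sigma> i + h'"] lh[OF that(1)] by (simp add: derived_def)
    ultimately show ?thesis
      using Push.prems(2) by (fastforce simp: F_def b_def average_freeze)
  qed
  \<comment> \<open>The unaligned letter joins the multiplier and the next lower pivot is examined;
    the budget of \<open>derived\<close> already accounts for the letter.\<close>
  have bad: "F i \<le> 8 * b" if "i \<in> A" for i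
    unfolding F_def b_def times_divide_eq_right
  proof (rule Push.IH[OF A(4)])
    fix s' assume "clean s'" "derived s (\<sigma> i + h') s'"
    then show "average s' f \<le> \<beta> / 4 ^ pivots s'"
      using lh[OF that] by (intro Push.prems(2)) (auto simp: derived_def)
  qed
  have "(\<Sum>i\<in>A. F i) \<le> (\<Sum>i\<in>A. b + (if good i then 0 else 8 * b))"
    using good bad b by (intro sum_mono) fastforce
  also have "\<dots> = card A * b + card {i \<in> A. \<not> good i} * (8 * b)"
    using A(3) by (simp add: sum.distrib sum.If_cases Int_def)
  also have "\<dots> \<le> card A * b + 3 * (8 * b)"
  proof -
    have "card {i \<in> A. \<not> good i} \<le> 3"
      unfolding good_def
      by (rule order_trans[OF card_mono card_bad[of "last_point s" "pt h'" "pt h'"]]) (use A in auto)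
    then show ?thesis using b by (intro add_left_mono mult_right_mono) auto
  qed
  \<comment> \<open>The three bad values contribute \<open>24 * b\<close>, absorbed by
    \<open>24 \<le> card A\<close>. Since \<open>b\<close> carries one pivot less than the full
    state, \<open>2 * b\<close> reproduces the factor 8.\<close>
  also have "\<dots> \<le> card A * (2 * b)"
  proof -
    have "24 * b \<le> card A * b" using b A(2) N by (intro mult_right_mono) auto
    then show ?thesis by (simp add: algebra_simps)
  qed
  finally have "(\<Sum>i\<in>A. F i) / card A \<le> 2 * b"
    using card_pos[OF Push.prems(1)] by (simp add: divide_le_eq mult.commute)
  moreover have "average (Push s A fs) (\<lambda>g. f (g + h)) = (\<Sum>i\<in>A. F i) / card A"
    by (simp add: F_def h'_def add.assoc)
  ultimately show ?case by (simp only: b_def) simp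
qed

section \<open>Averaging over two fresh letters\<close>

definition two_steps :: "('x isom \<Rightarrow> real) \<Rightarrow> real" where
  "two_steps f = (\<Sum>j<N. \<Sum>i<N. f (\<sigma> i + \<sigma> j)) / real N ^ 2"

lemma average_two_steps:
  "average s (\<lambda>g. two_steps (\<lambda>v. f g v)) = two_steps (\<lambda>v. average s (\<lambda>g. f g v))"
  by (simp add: two_steps_def average_divide average_sum)

text \<open>The first of the two letters becomes a new pivot, the second one separates it from \<open>w\<close>.\<close>

lemma average_two_steps_le:
  assumes s: "clean s" and \<beta>: "0 \<le> \<beta>"
    and f: "\<And>s'. clean s' \<Longrightarrow> extent s' \<le> extent s + 2 * smax + len w \<Longrightarrow>
      average s' f \<le> \<beta> / 4 ^ pivots s'"
  shows "average s (\<lambda>g. two_steps (\<lambda>v. f (g + v + w))) \<le> \<beta> / 2 / 4 ^ pivots s"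
proof -
  define b where "b = \<beta> / 4 ^ pivots s"
  have b: "0 \<le> b" using \<beta> by (simp add: b_def)
  define F where "F i j = average s (\<lambda>g. f (g + (\<sigma> i + \<sigma> j) + w))" for i j
  have any: "F i j \<le> 8 * b" if ij: "i < N" "j < N" for i j
  proof -
    have "len (\<sigma> i + (\<sigma> j + w)) \<le> 2 * smax + len w"
      using len_plus[of "\<sigma> i" "\<sigma> j + w"] len_plus[of "\<sigma> j" w] len_le_smax[OF ij(1)]
        len_le_smax[OF ij(2)] by linarith
    then have "average s (\<lambda>g. f (g + (\<sigma> i + (\<sigma> j + w)))) \<le> 8 * \<beta> / 4 ^ pivots s"
      using s \<beta> by (intro average_plus_le f) (auto simp: derived_def)
    then show ?thesis by (simp add: F_def b_def add.assoc)
  qed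
  have good: "(\<Sum>i<N. F i j) \<le> N * (b / 4) + 24 * b"
    if j: "j < N" "ip (pt (- \<sigma> j)) (pt w) \<le> C" for j
  proof -
    define w' where "w' = \<sigma> j + w"
    define A where "A = {i. i < N \<and> ip (last_point s) (pt (\<sigma> i)) \<le> C \<and> ip (pt (- \<sigma> i)) (pt w') \<le> C}"
    have w': "D \<le> len w'" using len_sigma_plus[OF j] by (simp add: w'_def)
    have bad3: "card ({..<N} - A) \<le> 3"
      by (rule order_trans[OF card_mono card_bad[of "last_point s" x0 "pt w'"]]) (auto simp: A_def)
    have A: "finite A" "A \<subseteq> {..<N}" by (auto simp: A_def)
    then have "card A + card ({..<N} - A) = N"
      by (metis card_Diff_subset card_lessThan card_mono finite_lessThan le_add_diff_inverse)
    then have card: "N \<le> card A + 3" "card A \<le> N" using bad3 by auto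
    have "clean (Push s A [w'])"
      using s A card w' len_sigma C_nonneg unfolding A_def
      by (auto intro: order_trans[OF _ len_sigma])
    moreover have "extent (Push s A [w']) \<le> extent s + 2 * smax + len w"
      using len_plus[of "\<sigma> j" w] len_le_smax[OF j(1)] by (simp add: w'_def)
    ultimately have "average (Push s A [w']) f \<le> b / 4"
      using f[of "Push s A [w']"] by (simp add: b_def)
    moreover have "average (Push s A [w']) f = (\<Sum>i\<in>A. F i j) / card A"
      by (simp add: F_def w'_def add.assoc)
    ultimately have "(\<Sum>i\<in>A. F i j) \<le> card A * (b / 4)"
      using card N by (simp add: divide_le_eq mult.commute)
    also have "\<dots> \<le> N * (b / 4)" using card b by (intro mult_right_mono) auto
    finally have "(\<Sum>i\<in>A. F i j) \<le> N * (b / 4)" .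
    moreover have "(\<Sum>i\<in>{..<N} - A. F i j) \<le> 24 * b"
    proof -
      have "(\<Sum>i\<in>{..<N} - A. F i j) \<le> card ({..<N} - A) * (8 * b)"
        using any j by (intro sum_bounded_above) auto
      also have "\<dots> \<le> 3 * (8 * b)" using bad3 b by (intro mult_right_mono) auto
      finally show ?thesis by simp
    qed
    ultimately show ?thesis using sum.subset_diff[OF A(2), of "\<lambda>i. F i j"] by simp
  qed
  have bad: "(\<Sum>i<N. F i j) \<le> N * (8 * b)" if "j < N" for j
    using sum_bounded_above[of "{..<N}" "\<lambda>i. F i j" "8 * b"] any that by simp
  define J where "J = {j. j < N \<and> C < ip (pt (- \<sigma> j)) (pt w)}"
  have J: "card J \<le> 1" "J \<subseteq> {..<N}" using schottky by (auto simp: schottky_def J_def)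
  have "(\<Sum>j<N. \<Sum>i<N. F i j) \<le> (\<Sum>j<N. N * (b / 4) + 24 * b + (if j \<in> J then N * (8 * b) else 0))"
  proof (intro sum_mono)
    fix j assume "j \<in> {..<N}"
    then have j: "j < N" by simp
    have pos: "0 \<le> N * (b / 4) + 24 * b" using b by simp
    show "(\<Sum>i<N. F i j) \<le> N * (b / 4) + 24 * b + (if j \<in> J then N * (8 * b) else 0)"
    proof (cases "j \<in> J")
      case True
      then have "(if j \<in> J then N * (8 * b) else 0) = N * (8 * b)" by simp
      then show ?thesis using add_mono[OF pos bad[OF j]] by linarith
    next
      case False
      then show ?thesis using good[OF j] j by (simp add: J_def)
    qed
  qed
  also have "\<dots> = N * (N * (b / 4) + 24 * b) + card J * (N * (8 * b))"
    using J(2) by (simp add: sum.distrib sum.If_cases Int_absorb1)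
  also have "\<dots> \<le> N * (N * (b / 4) + 24 * b) + 1 * (N * (8 * b))"
    using J(1) b by (intro add_left_mono mult_right_mono) auto
  \<comment> \<open>A new pivot gains 1/4. Exceptional first letters cost \<open>24 * N * b\<close>
    and the one exceptional second letter \<open>8 * N * b\<close>; as \<open>128 \<le> N\<close>
    this is at most another quarter, whence 1/2.\<close>
  also have "\<dots> = real N ^ 2 * (b / 4) + 32 * (N * b)"
    by (simp add: algebra_simps power2_eq_square)
  also have "32 * (N * b) \<le> real N ^ 2 * (b / 4)"
  proof -
    have "128 * (N * b) \<le> N * (N * b)" using N b by (intro mult_right_mono) auto
    then show ?thesis by (simp add: power2_eq_square mult.assoc)
  qed
  finally have "(\<Sum>j<N. \<Sum>i<N. F i j) \<le> b / 2 * real N ^ 2" by (simp add: algebra_simps)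
  then have "(\<Sum>j<N. \<Sum>i<N. F i j) / real N ^ 2 \<le> b / 2"
    using N by (subst pos_divide_le_eq) auto
  then show ?thesis
    unfolding average_two_steps[where f = "\<lambda>g v. f (g + v + w)"]
    by (simp add: two_steps_def F_def b_def)
qed

end

section \<open>Finitely supported walks\<close>

text \<open>Total weight at most 1 admits restrictions of a probability measure to finite sets;
  \<open>walk n f\<close> below is the corresponding integral of \<open>f\<close> over
  \<open>n\<close> steps.\<close>

locale weighted_steps =
  fixes wt :: "'g \<Rightarrow> real" and \<iota> :: "'g \<Rightarrow> 'x::metric_space isom" and H :: "'g set"
  assumes finite_steps: "finite H" and wt_nonneg: "\<And>h. 0 \<le> wt h" and wt_sum: "sum wt H \<le> 1"
begin

primrec walk :: "nat \<Rightarrow> ('x isom \<Rightarrow> real) \<Rightarrow> real" where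
  "walk 0 f = f 0"
| "walk (Suc n) f = (\<Sum>h\<in>H. wt h * walk n (\<lambda>x. f (\<iota> h + x)))"

lemma walk_add: "walk (m + n) f = walk m (\<lambda>x. walk n (\<lambda>y. f (x + y)))"
  by (induction m arbitrary: f) (simp_all add: add.assoc)

lemma walk_sum: "walk n (\<lambda>x. \<Sum>i\<in>I. f i x) = (\<Sum>i\<in>I. walk n (f i))"
proof (induction n arbitrary: f)
  case (Suc n)
  show ?case by (simp add: Suc sum_distrib_left) (rule sum.swap)
qed simp

lemma walk_cmult: "walk n (\<lambda>x. c * f x) = c * walk n f"
  by (induction n arbitrary: f) (simp_all add: sum_distrib_left mult_ac)

lemma walk_diff: "walk n (\<lambda>x. f x - g x) = walk n f - walk n g"
  by (induction n arbitrary: f g) (simp_all add: sum_subtractf right_diff_distrib)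

lemma walk_plus: "walk n (\<lambda>x. f x + g x) = walk n f + walk n g"
  by (induction n arbitrary: f g) (simp_all add: sum.distrib distrib_left)

lemma walk_swap: "walk m (\<lambda>x. walk n (\<lambda>y. F x y)) = walk n (\<lambda>y. walk m (\<lambda>x. F x y))"
proof (induction m arbitrary: F)
  case (Suc m)
  show ?case by (simp add: Suc walk_sum walk_cmult)
qed simp

lemma walk_mono: "(\<And>x. f x \<le> g x) \<Longrightarrow> walk n f \<le> walk n g"
  by (induction n arbitrary: f g) (auto intro!: sum_mono mult_left_mono wt_nonneg)

lemma walk_const_le:
  assumes "0 \<le> c"
  shows "walk n (\<lambda>x. c) \<le> c"
proof (induction n)
  case (Suc n)
  have "walk (Suc n) (\<lambda>x. c) \<le> sum wt H * c"
    using Suc by (simp add: sum_distrib_right sum_mono mult_left_mono wt_nonneg)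
  also have "\<dots> \<le> 1 * c" using assms wt_sum by (intro mult_right_mono)
  finally show ?case by simp
qed simp

lemma walk_le:
  assumes "\<And>x. f x \<le> c" "0 \<le> c"
  shows "walk n f \<le> c"
  using order_trans[OF walk_mono walk_const_le] assms by blast

lemma walk_nonneg: "(\<And>x. 0 \<le> f x) \<Longrightarrow> 0 \<le> walk n f"
  by (induction n arbitrary: f) (auto intro!: sum_nonneg mult_nonneg_nonneg wt_nonneg)

lemma walk_cong_len:
  assumes "\<And>h. h \<in> H \<Longrightarrow> dist x0 (\<iota> h \<triangleright> x0) \<le> B"
    and "\<And>x. dist x0 (x \<triangleright> x0) \<le> real n * B \<Longrightarrow> f x = g x"
  shows "walk n f = walk n g"
  using assms(2)
proof (induction n arbitrary: f g)
  case (Suc n)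
  have "walk n (\<lambda>x. f (\<iota> h + x)) = walk n (\<lambda>x. g (\<iota> h + x))" if h: "h \<in> H" for h
  proof (rule Suc.IH)
    fix x assume x: "dist x0 (x \<triangleright> x0) \<le> real n * B"
    have "dist x0 ((\<iota> h + x) \<triangleright> x0) \<le> dist x0 (\<iota> h \<triangleright> x0) + dist x0 (x \<triangleright> x0)"
      using dist_triangle[of x0 "\<iota> h \<triangleright> x \<triangleright> x0" "\<iota> h \<triangleright> x0"] by simp
    then show "f (\<iota> h + x) = g (\<iota> h + x)"
      using x assms(1)[OF h] by (intro Suc.prems) (simp add: algebra_simps)
  qed
  then show ?case by simp
qed simp

end

lemma weighted_steps_subset:
  assumes "weighted_steps wt H" "H' \<subseteq> H"
  shows "weighted_steps wt H'"
proof -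
  interpret weighted_steps wt undefined H by fact
  have "sum wt H' \<le> sum wt H" using assms(2) finite_steps wt_nonneg by (intro sum_mono2) auto
  then show ?thesis
    using assms(2) finite_steps wt_nonneg wt_sum by unfold_locales (auto intro: finite_subset)
qed

text \<open>Union bound over the times at which a step leaves \<open>H'\<close>, using
  \<open>f \<le> 1\<close> from then on.\<close>

lemma walk_subset_le:
  fixes f :: "'x::metric_space isom \<Rightarrow> real"
  assumes "weighted_steps wt H" "H' \<subseteq> H" and f: "\<And>x. 0 \<le> f x" "\<And>x. f x \<le> 1"
  shows "weighted_steps.walk wt \<iota> H n f \<le> weighted_steps.walk wt \<iota> H' n f + real n * sum wt (H - H')"
  using f
proof (induction n arbitrary: f)
  interpret H: weighted_steps wt \<iota> H by fact
  interpret H': weighted_steps wt \<iota> H' using weighted_steps_subset assms by blast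
  {
    case 0
    then show ?case by simp
  next
    case (Suc n)
    let ?r = "sum wt (H - H')"
    have r: "0 \<le> ?r" by (intro sum_nonneg) (rule H.wt_nonneg)
    have "H.walk (Suc n) f = (\<Sum>h\<in>H'. wt h * H.walk n (\<lambda>x. f (\<iota> h + x))) +
        (\<Sum>h\<in>H - H'. wt h * H.walk n (\<lambda>x. f (\<iota> h + x)))"
      using sum.subset_diff[OF assms(2) H.finite_steps] by (simp add: add.commute)
    also have "(\<Sum>h\<in>H - H'. wt h * H.walk n (\<lambda>x. f (\<iota> h + x))) \<le> (\<Sum>h\<in>H - H'. wt h * 1)"
      using Suc.prems by (intro sum_mono mult_left_mono H.walk_le H.wt_nonneg) auto
    also have "(\<Sum>h\<in>H'. wt h * H.walk n (\<lambda>x. f (\<iota> h + x))) \<le>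
        (\<Sum>h\<in>H'. wt h * (H'.walk n (\<lambda>x. f (\<iota> h + x)) + n * ?r))"
      using Suc.prems by (intro sum_mono mult_left_mono Suc.IH H.wt_nonneg) auto
    also have "\<dots> = H'.walk (Suc n) f + sum wt H' * (n * ?r)"
      by (simp add: distrib_left sum.distrib sum_distrib_right)
    also have "sum wt H' * (n * ?r) \<le> 1 * (n * ?r)"
      using H'.wt_sum r by (intro mult_right_mono) auto
    finally show ?case by (simp add: algebra_simps)
  }
qed

primrec words :: "('g \<Rightarrow> 'x::metric_space isom) \<Rightarrow> 'g set \<Rightarrow> nat \<Rightarrow> 'x isom set" where
  "words \<iota> A 0 = {0}"
| "words \<iota> A (Suc n) = {\<iota> h + x | h x. h \<in> A \<and> x \<in> words \<iota> A n}"

lemma words_plus: "x \<in> words \<iota> A m \<Longrightarrow> y \<in> words \<iota> A n \<Longrightarrow> x + y \<in> words \<iota> A (m + n)"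
  by (induction m arbitrary: x) (force simp: add.assoc)+

text \<open>The constant is the product of the weights of the letters spelling \<open>x\<close>, and
  serves every \<open>H\<close> that contains these letters.\<close>

lemma walk_ge_word:
  fixes \<iota> :: "'g \<Rightarrow> 'x::metric_space isom"
  assumes "x \<in> words \<iota> A n" "\<And>h. h \<in> A \<Longrightarrow> 0 < wt h"
  shows "\<exists>F c. finite F \<and> F \<subseteq> A \<and> 0 < c \<and> (\<forall>H f. weighted_steps wt H \<longrightarrow> F \<subseteq> H \<longrightarrow>
    (\<forall>y. 0 \<le> f y) \<longrightarrow> c * f x \<le> weighted_steps.walk wt \<iota> H n f)"
  using assms(1)
proof (induction n arbitrary: x)
  case 0
  have "1 * f x \<le> weighted_steps.walk wt \<iota> H 0 f" if "weighted_steps wt H" for H f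
  proof -
    interpret weighted_steps wt \<iota> H by fact
    show ?thesis using 0 by simp
  qed
  then show ?case by (intro exI[of _ "{}"] exI[of _ 1]) auto
next
  case (Suc n)
  then obtain h y where x: "x = \<iota> h + y" "h \<in> A" "y \<in> words \<iota> A n" by auto
  obtain F c where F: "finite F" "F \<subseteq> A" and c: "0 < c"
    and le: "\<And>H f. weighted_steps wt H \<Longrightarrow> F \<subseteq> H \<Longrightarrow> (\<forall>y. 0 \<le> f y) \<Longrightarrow>
      c * f y \<le> weighted_steps.walk wt \<iota> H n f"
    using Suc.IH[OF x(3)] by blast
  have "wt h * c * f x \<le> weighted_steps.walk wt \<iota> H (Suc n) f"
    if H: "weighted_steps wt H" "insert h F \<subseteq> H" and f: "\<forall>y. 0 \<le> f y" for H f
  proof -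
    interpret weighted_steps wt \<iota> H by fact
    have "wt h * c * f x \<le> wt h * walk n (\<lambda>x. f (\<iota> h + x))"
      using le[OF H(1), of "\<lambda>x. f (\<iota> h + x)"] H(2) f x(1) mult_left_mono[OF _ wt_nonneg[of h]]
      by (simp add: mult.assoc)
    also have "\<dots> \<le> walk (Suc n) f"
      unfolding walk.simps using f finite_steps H(2)
      by (intro member_le_sum mult_nonneg_nonneg walk_nonneg wt_nonneg) auto
    finally show ?thesis .
  qed
  moreover have "0 < wt h * c" using assms(2)[OF x(2)] c by simp
  ultimately show ?case
    using F x(2) by (intro exI[of _ "insert h F"] exI[of _ "wt h * c"]) auto
qed

section \<open>Contraction\<close>

text \<open>\<open>minorization\<close> is a Doeblin condition: with weight \<alpha>, a block of
  \<open>M\<close> steps is a pair of uniform letters. It replaces an explicit splitting of the walk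
  into blocks of two kinds.\<close>

locale pivoting_walk = pivoting x0 \<delta> C N \<sigma> z + weighted_steps wt \<iota> H
  for x0 :: "'x::metric_space" and \<delta> C N \<sigma> z
    and wt :: "'g \<Rightarrow> real" and \<iota> :: "'g \<Rightarrow> 'x isom" and H +
  fixes M :: nat and \<alpha> B :: real
  assumes alpha: "0 < \<alpha>" "\<alpha> \<le> 1"
    and minorization: "\<And>f. (\<And>x. 0 \<le> f x) \<Longrightarrow> \<alpha> * two_steps f \<le> walk M f"
    and steps_bounded: "\<And>h. h \<in> H \<Longrightarrow> len (\<iota> h) \<le> B" and B_nonneg: "0 \<le> B"
begin

lemma two_steps_const [simp]: "two_steps (\<lambda>v. c) = c"
  using N by (simp add: two_steps_def power2_eq_square)

lemma two_steps_mono: "(\<And>v. f v \<le> g v) \<Longrightarrow> two_steps f \<le> two_steps g"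
  unfolding two_steps_def by (intro divide_right_mono sum_mono) auto

lemma two_steps_diff: "two_steps (\<lambda>v. f v - g v) = two_steps f - two_steps g"
  by (simp add: two_steps_def sum_subtractf diff_divide_distrib)

lemma two_steps_swap:
  "two_steps (\<lambda>v. two_steps (\<lambda>h. F v h)) = two_steps (\<lambda>h. two_steps (\<lambda>v. F v h))"
proof -
  define q where "q p = \<sigma> (snd p) + \<sigma> (fst p)" for p
  have "two_steps f = (\<Sum>p\<in>{..<N} \<times> {..<N}. f (q p)) / real N ^ 2" for f
    by (simp add: two_steps_def sum.cartesian_product split_beta q_def)
  moreover have "(\<Sum>p\<in>{..<N} \<times> {..<N}. \<Sum>p'\<in>{..<N} \<times> {..<N}. F (q p) (q p')) =
      (\<Sum>p'\<in>{..<N} \<times> {..<N}. \<Sum>p\<in>{..<N} \<times> {..<N}. F (q p) (q p'))"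
    by (rule sum.swap)
  ultimately show ?thesis by (simp flip: sum_divide_distrib)
qed

text \<open>Minorization is applied to \<open>s - \<phi>\<close>, which is known to be nonnegative
  only on elements that \<open>M\<close> steps can reach; hence the detour through
  \<open>max 0\<close>.\<close>

lemma walk_le_two_steps:
  assumes \<phi>: "\<And>h. len h \<le> real M * B \<Longrightarrow> \<phi> h \<le> s" and s: "0 \<le> s"
  shows "walk M \<phi> \<le> \<alpha> * two_steps \<phi> + (1 - \<alpha>) * s"
proof -
  have "\<alpha> * (s - two_steps \<phi>) = \<alpha> * two_steps (\<lambda>h. s - \<phi> h)" by (simp add: two_steps_diff)
  also have "\<dots> \<le> \<alpha> * two_steps (\<lambda>h. max 0 (s - \<phi> h))"
    using alpha by (intro mult_left_mono two_steps_mono) auto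
  also have "\<dots> \<le> walk M (\<lambda>h. max 0 (s - \<phi> h))" by (rule minorization) simp
  also have "\<dots> = walk M (\<lambda>h. s - \<phi> h)"
    using \<phi> by (intro walk_cong_len[OF steps_bounded]) auto
  also have "\<dots> \<le> s - walk M \<phi>" using walk_const_le[OF s, of M] by (simp add: walk_diff)
  finally show ?thesis by (simp add: algebra_simps)
qed

text \<open>The quantity contracted by the walk: two fresh letters followed by an arbitrary \<open>w\<close>.\<close>

definition controlled :: "real \<Rightarrow> real \<Rightarrow> ('x isom \<Rightarrow> real) \<Rightarrow> bool" where
  "controlled \<beta> R f \<longleftrightarrow>
     (\<forall>s w. clean s \<and> extent s + 2 * smax + len w \<le> R \<longrightarrow>
        average s (\<lambda>g. two_steps (\<lambda>v. f (g + v + w))) \<le> \<beta> / 4 ^ pivots s) \<and>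
     (\<forall>w. len w \<le> R \<longrightarrow> f w \<le> 2 * \<beta>)"

lemma controlled_start:
  assumes "0 \<le> \<beta>" and f: "\<And>s. clean s \<Longrightarrow> extent s \<le> R \<Longrightarrow> average s f \<le> \<beta> / 4 ^ pivots s"
  shows "controlled (\<beta> / 2) R f"
  unfolding controlled_def
proof (intro conjI allI impI; (elim conjE)?)
  fix s w assume "clean s" "extent s + 2 * smax + len w \<le> R"
  then show "average s (\<lambda>g. two_steps (\<lambda>v. f (g + v + w))) \<le> \<beta> / 2 / 4 ^ pivots s"
    using assms by (intro average_two_steps_le) auto
next
  fix w assume "len w \<le> R"
  then show "f w \<le> 2 * (\<beta> / 2)" using f[of "Base w []"] by simp
qed

lemma average_walk: "average s (\<lambda>g. walk n (\<lambda>h. F g h)) = walk n (\<lambda>h. average s (\<lambda>g. F g h))"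
proof (induction n arbitrary: F)
  case (Suc n)
  show ?case by (simp add: average_sum average_cmult Suc)
qed simp

lemma two_steps_walk: "two_steps (\<lambda>v. walk n (\<lambda>h. F v h)) = walk n (\<lambda>h. two_steps (\<lambda>v. F v h))"
  using walk_cmult[of n "1 / real N ^ 2" "\<lambda>h. \<Sum>j<N. \<Sum>i<N. F (\<sigma> i + \<sigma> j) h"]
  by (simp add: two_steps_def walk_sum)

text \<open>With weight \<alpha> the new block is a pair of letters, which takes over the role of
  the fresh pair in the hypothesis on \<open>f\<close>; the older pair \<open>v\<close> can then
  become a pivot and gains 1/2. With the remaining weight the block is absorbed into
  \<open>w\<close>. Together this is 1 - \<alpha>/2, at the price of one block and two letters of
  budget.\<close>

lemma controlled_step:
  assumes \<beta>: "0 \<le> \<beta>" and f: "controlled \<beta> R f"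
  shows "controlled ((1 - \<alpha> / 2) * \<beta>) (R - (real M * B + 2 * smax)) (\<lambda>x. walk M (\<lambda>h. f (x + h)))"
  unfolding controlled_def
proof (intro conjI allI impI; (elim conjE)?)
  fix s w assume s: "clean s" and R: "extent s + 2 * smax + len w \<le> R - (real M * B + 2 * smax)"
  define b where "b = \<beta> / 4 ^ pivots s"
  have b: "0 \<le> b" using \<beta> by (simp add: b_def)
  define \<phi> where "\<phi> h = average s (\<lambda>g. two_steps (\<lambda>v. f (g + v + w + h)))" for h
  have "average s (\<lambda>g. two_steps (\<lambda>v. walk M (\<lambda>h. f (g + v + w + h)))) = walk M \<phi>"
    by (simp add: \<phi>_def[abs_def] average_walk two_steps_walk)
  also have "\<dots> \<le> \<alpha> * two_steps \<phi> + (1 - \<alpha>) * b"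
  proof (rule walk_le_two_steps[OF _ b])
    fix h assume "len h \<le> real M * B"
    then have "extent s + 2 * smax + len (w + h) \<le> R"
      using R len_plus[of w h] smax_nonneg by simp
    then show "\<phi> h \<le> b"
      using f s unfolding controlled_def \<phi>_def b_def by (simp add: add.assoc)
  qed
  also have "two_steps \<phi> = average s (\<lambda>g. two_steps (\<lambda>v. two_steps (\<lambda>h. f (g + v + w + h))))"
    unfolding \<phi>_def average_two_steps[symmetric] by (subst two_steps_swap) (rule refl)
  also have "\<dots> \<le> b / 2"
  proof -
    have "average s (\<lambda>g. two_steps (\<lambda>v. two_steps (\<lambda>h. f (g + v + w + h)))) \<le> \<beta> / 2 / 4 ^ pivots s"
    proof (rule average_two_steps_le[OF s \<beta>, where f = "\<lambda>x. two_steps (\<lambda>h. f (x + h))"])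
      fix s' assume s': "clean s'" "extent s' \<le> extent s + 2 * smax + len w"
      have "extent s' + 2 * smax + len 0 \<le> R"
        using s'(2) R mult_nonneg_nonneg[OF _ B_nonneg, of "real M"] by simp
      then show "average s' (\<lambda>g. two_steps (\<lambda>h. f (g + h))) \<le> \<beta> / 4 ^ pivots s'"
        using conjunct1[OF f[unfolded controlled_def], rule_format, of s' 0] s'(1) by simp
    qed
    then show ?thesis by (simp add: b_def)
  qed
  finally have "average s (\<lambda>g. two_steps (\<lambda>v. walk M (\<lambda>h. f (g + v + w + h)))) \<le>
    \<alpha> * (b / 2) + (1 - \<alpha>) * b" using alpha by (simp add: mult_left_mono)
  then show "average s (\<lambda>g. two_steps (\<lambda>v. walk M (\<lambda>h. f (g + v + w + h)))) \<le>
    (1 - \<alpha> / 2) * \<beta> / 4 ^ pivots s" by (simp add: b_def algebra_simps diff_divide_distrib)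
next
  fix w assume R: "len w \<le> R - (real M * B + 2 * smax)"
  have MB: "0 \<le> real M * B" using B_nonneg by simp
  have "walk M (\<lambda>h. f (w + h)) \<le> \<alpha> * two_steps (\<lambda>h. f (w + h)) + (1 - \<alpha>) * (2 * \<beta>)"
  proof (rule walk_le_two_steps)
    fix h assume "len h \<le> real M * B"
    then have "len (w + h) \<le> R" using R len_plus[of w h] smax_nonneg by simp
    then show "f (w + h) \<le> 2 * \<beta>" using f by (simp add: controlled_def)
  qed (use \<beta> in simp)
  also have "two_steps (\<lambda>h. f (w + h)) \<le> \<beta>"
    using f R MB unfolding controlled_def
    by (auto dest!: spec[of _ "Base w []"] spec[of _ 0])
  finally have "walk M (\<lambda>h. f (w + h)) \<le> \<alpha> * \<beta> + (1 - \<alpha>) * (2 * \<beta>)"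
    using alpha by (simp add: mult_left_mono)
  then show "walk M (\<lambda>h. f (w + h)) \<le> 2 * ((1 - \<alpha> / 2) * \<beta>)" by (simp add: algebra_simps)
qed

lemma walk_contraction:
  assumes "0 \<le> \<beta>"
    and "\<And>s. clean s \<Longrightarrow> extent s \<le> real k * (real M * B + 2 * smax) \<Longrightarrow>
      average s f \<le> \<beta> / 4 ^ pivots s"
  shows "walk (k * M) f \<le> (1 - \<alpha> / 2) ^ k * \<beta>"
proof -
  define r where "r = real M * B + 2 * smax"
  have "controlled ((1 - \<alpha> / 2) ^ j * (\<beta> / 2)) (real k * r - real j * r)
    (\<lambda>x. walk (j * M) (\<lambda>h. f (x + h)))" for j
  proof (induction j)
    case 0
    then show ?case using controlled_start[OF assms(1)] assms(2) by (simp add: r_def)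
  next
    case (Suc j)
    have "controlled ((1 - \<alpha> / 2) * ((1 - \<alpha> / 2) ^ j * (\<beta> / 2))) (real k * r - real j * r - r)
      (\<lambda>x. walk M (\<lambda>h. walk (j * M) (\<lambda>h'. f (x + h + h'))))"
      using controlled_step[OF _ Suc] assms(1) alpha by (simp add: r_def)
    moreover have "(1 - \<alpha> / 2) * ((1 - \<alpha> / 2) ^ j * (\<beta> / 2)) = (1 - \<alpha> / 2) ^ Suc j * (\<beta> / 2)"
      by simp
    moreover have "real k * r - real j * r - r = real k * r - real (Suc j) * r"
      by (simp add: algebra_simps)
    ultimately show ?case by (simp only: walk_add mult_Suc add.assoc)
  qed
  \<comment> \<open>The second clause at the identity; its factor 2 cancels the 1/2 of
    \<open>controlled_start\<close>.\<close>
  from conjunct2[OF this[of k, unfolded controlled_def], rule_format, of 0] show ?thesis by simp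
qed

text \<open>\<open>D\<close> exceeds \<open>2 * C + 2 * \<delta>\<close> by 1, so each pivot adds at
  least 1 to the distance and a state with more than \<open>t\<close> pivots avoids the
  event.\<close>

lemma walk_dist_le:
  "walk (k * M) (\<lambda>x. of_bool (dist z (pt x) \<le> t)) \<le> (1 - \<alpha> / 2) ^ k * 4 powr t"
proof (rule walk_contraction)
  fix s assume s: "clean s"
  show "average s (\<lambda>x. of_bool (dist z (pt x) \<le> t)) \<le> 4 powr t / 4 ^ pivots s"
  proof (rule average_le[OF s])
    fix es assume es: "chain C D (- base s \<triangleright> z) es" "pivots s \<le> length es"
    have "real (pivots s) \<le> dist z (pt (base s + sum_list es))"
    proof -
      have "dist (- base s \<triangleright> z) (pt (sum_list es)) = dist z (pt (base s + sum_list es))"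
        using dist_app_left[of "- base s" z "pt (sum_list es)"] by simp
      then show ?thesis
        using chain_product_D(2)[OF es(1)] es(2) zero_le_dist[of "- base s \<triangleright> z" x0] by linarith
    qed
    then show "of_bool (dist z (pt (base s + sum_list es)) \<le> t) \<le> 4 powr t / (4::real) ^ pivots s"
      by (auto simp: of_bool_def le_divide_eq powr_realpow[symmetric] intro!: powr_mono)
  qed
qed simp

text \<open>If a pivot survives multiplication by \<open>y\<close>, the base is still that of
  \<open>s\<close>, and the product with \<open>z\<close> exceeds its length by at most
  \<open>C + \<delta>\<close>, whatever follows. If none survives, the trivial bound 1 is already
  the required one. The 8 is the loss in \<open>average_plus_le\<close>.\<close>

lemma walk_ip_le:
  assumes R: "real k * (real M * B + 2 * smax) + C + \<delta> \<le> R"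
  shows "walk (k * M) (\<lambda>x. of_bool (R < ip z (pt (x + y)))) \<le> 8 * (1 - \<alpha> / 2) ^ k"
proof -
  have "walk (k * M) (\<lambda>x. of_bool (R < ip z (pt (x + y)))) \<le> (1 - \<alpha> / 2) ^ k * 8"
  proof (rule walk_contraction)
    fix s assume s: "clean s" and ext: "extent s \<le> real k * (real M * B + 2 * smax)"
    have "average s (\<lambda>g. of_bool (R < ip z (pt (g + y)))) \<le> 8 * 1 / 4 ^ pivots s"
    proof (rule average_plus_le[OF s, where f = "\<lambda>g. of_bool (R < ip z (pt g))"])
      fix s' assume s': "clean s'" "derived s y s'"
      show "average s' (\<lambda>g. of_bool (R < ip z (pt g))) \<le> 1 / 4 ^ pivots s'"
      proof (rule average_le[OF s'(1)])
        fix es assume es: "chain C D (- base s' \<triangleright> z) es"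
        show "of_bool (R < ip z (pt (base s' + sum_list es))) \<le> 1 / (4::real) ^ pivots s'"
        proof (cases "pivots s' = 0")
          case False
          then have "len (base s') \<le> R - C - \<delta>"
            using s'(2) len_base_le[of s] ext R by (auto simp: derived_def)
          then have "ip z (pt (base s' + sum_list es)) \<le> R"
            using ip_app_le[of "base s'" "- base s' \<triangleright> z" "pt (sum_list es)"]
              chain_product_D(1)[OF es] by simp
          then show ?thesis by simp
        qed simp
      qed
    qed simp
    then show "average s (\<lambda>x. of_bool (R < ip z (pt (x + y)))) \<le> 8 / 4 ^ pivots s" by simp
  qed simp
  then show ?thesis by simp
qed

end

section \<open>Estimates for the walk\<close>

lemma power_div_le:
  fixes c :: real
  assumes "0 < c" "c < 1" "0 < M"
  shows "c ^ (n div M) \<le> 1 / c * (c powr (1 / M)) ^ n"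
proof -
  have "real n / M - 1 \<le> real (n div M)"
  proof -
    have "real n = real M * real (n div M) + real (n mod M)"
      by (metis mult_div_mod_eq of_nat_add of_nat_mult)
    moreover have "real (n mod M) \<le> real M" using assms(3) by (simp add: less_imp_le)
    ultimately have "real n \<le> real M * (real (n div M) + 1)" by (simp add: algebra_simps)
    then show ?thesis using assms(3) by (simp add: field_simps)
  qed
  then have "c powr real (n div M) \<le> c powr (real n / M - 1)"
    using assms by (intro powr_mono') auto
  also have "\<dots> = 1 / c * (c powr (1 / M)) ^ n"
    using assms by (simp add: powr_diff powr_powr flip: powr_realpow)
  finally show ?thesis using assms by (simp add: powr_realpow)
qed

text \<open>\<open>minor\<close> holds for all \<open>H\<close> containing \<open>F\<close> with the
  same \<alpha> and \<open>M\<close>; this makes the constants below independent of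
  \<open>H\<close>.\<close>

locale schottky_walk = four_point_space x0 \<delta> for x0 :: "'x::metric_space" and \<delta> +
  fixes C :: real and \<sigma> :: "nat \<Rightarrow> 'x isom" and wt :: "'g \<Rightarrow> real" and \<iota> :: "'g \<Rightarrow> 'x isom"
    and F :: "'g set" and M :: nat and \<alpha> :: real
  assumes schottky: "schottky C 200 \<sigma>" and alpha: "0 < \<alpha>" "\<alpha> \<le> 1" and M: "0 < M"
    and minor: "\<And>H f i j. weighted_steps wt H \<Longrightarrow> F \<subseteq> H \<Longrightarrow> (\<And>y. 0 \<le> f y) \<Longrightarrow> i < 200 \<Longrightarrow>
      j < 200 \<Longrightarrow> \<alpha> * f (\<sigma> i + \<sigma> j) \<le> weighted_steps.walk wt \<iota> H M f"
begin

lemma pivoting_walkI: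
  assumes "weighted_steps wt H" "F \<subseteq> H" "\<And>h. h \<in> H \<Longrightarrow> len (\<iota> h) \<le> B" "0 \<le> B"
  shows "pivoting_walk x0 \<delta> C 200 \<sigma> wt \<iota> H M \<alpha> B"
proof -
  interpret H: weighted_steps wt \<iota> H by fact
  interpret pivoting x0 \<delta> C 200 \<sigma> z for z using schottky by unfold_locales auto
  have "\<alpha> * two_steps f \<le> H.walk M f" if f: "\<And>x. 0 \<le> f x" for f
  proof -
    have "(\<Sum>j<200. \<Sum>i<200. \<alpha> * f (\<sigma> i + \<sigma> j)) \<le> (\<Sum>j<200::nat. \<Sum>i<200::nat. H.walk M f)"
      using minor[OF assms(1,2), of f] f by (intro sum_mono) auto
    then have "\<alpha> * (\<Sum>j<200. \<Sum>i<200. f (\<sigma> i + \<sigma> j)) \<le> 40000 * H.walk M f"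
      by (simp add: sum_distrib_left)
    then show ?thesis by (simp add: two_steps_def)
  qed
  then show ?thesis using alpha assms by unfold_locales auto
qed

definition \<theta> :: real where "\<theta> = 1 - \<alpha> / 2"

lemma theta: "0 < \<theta>" "\<theta> < 1"
  using alpha by (auto simp: \<theta>_def)

lemma steps_bound:
  assumes "weighted_steps wt H"
  obtains B where "0 \<le> B" "\<And>h. h \<in> H \<Longrightarrow> len (\<iota> h) \<le> B"
proof -
  interpret weighted_steps wt \<iota> H by fact
  show ?thesis
  proof (rule that)
    show "0 \<le> (\<Sum>h\<in>H. len (\<iota> h))" by (intro sum_nonneg) auto
    show "len (\<iota> h) \<le> (\<Sum>h\<in>H. len (\<iota> h))" if "h \<in> H" for h
      using that finite_steps by (intro member_le_sum) auto
  qed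
qed

lemma linear_progress:
  "\<exists>\<kappa> K c. 0 < \<kappa> \<and> 0 < K \<and> 0 < c \<and> c < 1 \<and> (\<forall>H z n. weighted_steps wt H \<longrightarrow> F \<subseteq> H \<longrightarrow>
    weighted_steps.walk wt \<iota> H n (\<lambda>x. of_bool (dist z (pt x) \<le> \<kappa> * real n)) \<le> K * c ^ n)"
proof -
  define a where "a = \<theta> powr (1 / M)"
  have a: "0 < a" "a < 1"
    using theta M powr_less_mono'[of \<theta> 0 "1 / M"] by (auto simp: a_def)
  \<comment> \<open>Chosen so that the factor \<open>4 powr (\<kappa> * n)\<close> of
    \<open>walk_dist_le\<close> uses up half of the decay exponent.\<close>
  define \<kappa> where "\<kappa> = - ln a / (2 * ln 4)"
  define c where "c = 4 powr \<kappa> * a"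
  have \<kappa>: "0 < \<kappa>" using a by (simp add: \<kappa>_def divide_neg_pos)
  have c_eq: "c = exp (ln a / 2)"
  proof -
    have "ln (4::real) \<noteq> 0" by simp
    then have "4 powr \<kappa> = exp (- ln a / 2)" by (simp add: \<kappa>_def powr_def)
    moreover have "exp (- ln a / 2) * exp (ln a) = exp (ln a / 2)"
      by (simp flip: exp_add)
    ultimately show ?thesis using a by (simp add: c_def)
  qed
  then have c: "0 < c" "c < 1" using a by auto
  have "weighted_steps.walk wt \<iota> H n (\<lambda>x. of_bool (dist z (pt x) \<le> \<kappa> * real n)) \<le> 1 / \<theta> * c ^ n"
    if H: "weighted_steps wt H" "F \<subseteq> H" for H z n
  proof -
    interpret H: weighted_steps wt \<iota> H by fact
    obtain B where B: "0 \<le> B" "\<And>h. h \<in> H \<Longrightarrow> len (\<iota> h) \<le> B" using steps_bound[OF H(1)] by blast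
    interpret P: pivoting_walk x0 \<delta> C 200 \<sigma> z' wt \<iota> H M \<alpha> B for z'
      using pivoting_walkI[OF H B(2,1)] .
    define k where "k = n div M"
    have n: "n = n mod M + k * M" by (simp add: k_def)
    have "H.walk n (\<lambda>x. of_bool (dist z (pt x) \<le> \<kappa> * real n)) =
      H.walk (n mod M) (\<lambda>x. H.walk (k * M) (\<lambda>y. of_bool (dist z (pt (x + y)) \<le> \<kappa> * real n)))"
      by (subst n) (rule H.walk_add)
    also have "\<dots> \<le> \<theta> ^ k * 4 powr (\<kappa> * real n)"
    proof (rule H.walk_le)
      fix x
      have "dist z (pt (x + y)) = dist (- x \<triangleright> z) (pt y)" for y
        using dist_app_left[of "- x" z "pt y"] by simp
      then show "H.walk (k * M) (\<lambda>y. of_bool (dist z (pt (x + y)) \<le> \<kappa> * real n)) \<le>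
        \<theta> ^ k * 4 powr (\<kappa> * real n)"
        using P.walk_dist_le[of k "- x \<triangleright> z" "\<kappa> * real n"] by (simp add: \<theta>_def)
    qed (use theta in simp)
    also have "\<dots> \<le> 1 / \<theta> * a ^ n * 4 powr (\<kappa> * real n)"
      using power_div_le[OF theta M, of n] by (intro mult_right_mono) (auto simp: k_def a_def)
    also have "\<dots> = 1 / \<theta> * c ^ n"
      by (simp add: c_def power_mult_distrib powr_powr[symmetric] powr_realpow)
    finally show ?thesis .
  qed
  moreover have "0 < 1 / \<theta>" using theta by simp
  ultimately show ?thesis using \<kappa> c by blast
qed

text \<open>Pivots are made by the first \<open>k * M\<close> steps only; the later ones form an
  arbitrary suffix, so the bound does not deteriorate with \<open>n\<close>. Steps longer than
  \<open>B\<close> are likewise cut off only among the first ones.\<close>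

lemma shadow_decay:
  "\<exists>r\<ge>0. \<forall>H z n k B R. weighted_steps wt H \<longrightarrow> F \<subseteq> H \<longrightarrow> (\<forall>h\<in>F. len (\<iota> h) \<le> B) \<longrightarrow> 0 \<le> B \<longrightarrow>
    k * M \<le> n \<longrightarrow> real k * (real M * B + r) + r \<le> R \<longrightarrow>
    weighted_steps.walk wt \<iota> H n (\<lambda>x. of_bool (R < ip z (pt x))) \<le>
      8 * \<theta> ^ k + real (k * M) * sum wt {h \<in> H. B < len (\<iota> h)}"
proof -
  interpret pivoting x0 \<delta> C 200 \<sigma> z for z using schottky by unfold_locales auto
  define r where "r = 2 * smax + C + \<delta>"
  have r: "0 \<le> r" "2 * smax \<le> r" "C + \<delta> \<le> r"
    using smax_nonneg C_nonneg delta_nonneg by (auto simp: r_def)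
  have "weighted_steps.walk wt \<iota> H n (\<lambda>x. of_bool (R < ip z (pt x))) \<le>
      8 * \<theta> ^ k + real (k * M) * sum wt {h \<in> H. B < len (\<iota> h)}"
    if H: "weighted_steps wt H" "F \<subseteq> H" and B: "\<forall>h\<in>F. len (\<iota> h) \<le> B" "0 \<le> B"
      and k: "k * M \<le> n" and R: "real k * (real M * B + r) + r \<le> R" for H z n k B R
  proof -
    define H' where "H' = {h \<in> H. len (\<iota> h) \<le> B}"
    have H': "weighted_steps wt H'" by (rule weighted_steps_subset[OF H(1)]) (auto simp: H'_def)
    interpret H: weighted_steps wt \<iota> H by fact
    interpret H': weighted_steps wt \<iota> H' by fact
    interpret P: pivoting_walk x0 \<delta> C 200 \<sigma> z wt \<iota> H' M \<alpha> B
      using H(2) B by (intro pivoting_walkI[OF H']) (auto simp: H'_def)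
    have R': "real k * (real M * B + 2 * smax) + C + \<delta> \<le> R"
    proof -
      have "real k * (real M * B + 2 * smax) \<le> real k * (real M * B + r)"
        using r by (intro mult_left_mono) auto
      then show ?thesis using R r by linarith
    qed
    have sum: "sum wt (H - H') = sum wt {h \<in> H. B < len (\<iota> h)}"
      by (rule arg_cong[of _ _ "sum wt"]) (auto simp: H'_def)
    have nonneg: "0 \<le> sum wt (H - H')" by (intro sum_nonneg) (rule H.wt_nonneg)
    have "H.walk n (\<lambda>x. of_bool (R < ip z (pt x))) =
      H.walk (n - k * M) (\<lambda>y. H.walk (k * M) (\<lambda>x. of_bool (R < ip z (pt (x + y)))))"
      using H.walk_add[of "k * M" "n - k * M"] k by (subst H.walk_swap) simp
    also have "\<dots> \<le> 8 * \<theta> ^ k + real (k * M) * sum wt (H - H')"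
    proof (rule H.walk_le)
      fix y
      have "H.walk (k * M) (\<lambda>x. of_bool (R < ip z (pt (x + y)))) \<le>
        H'.walk (k * M) (\<lambda>x. of_bool (R < ip z (pt (x + y)))) + real (k * M) * sum wt (H - H')"
        by (intro walk_subset_le[OF H(1)]) (auto simp: H'_def)
      then show "H.walk (k * M) (\<lambda>x. of_bool (R < ip z (pt (x + y)))) \<le>
        8 * \<theta> ^ k + real (k * M) * sum wt (H - H')"
        using P.walk_ip_le[OF R', of y] by (simp add: \<theta>_def)
    qed (use theta nonneg in simp)
    finally show ?thesis by (simp only: sum)
  qed
  then show ?thesis using r(1) by blast
qed

end

section \<open>Products of two independent halves\<close>

context four_point_space
begin

text \<open>If \<open>u\<close> and \<open>v\<close> are long and do not cancel cyclically, then the axis of \<open>u + v\<close> passes near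
  the basepoint.\<close>

lemma translation_length_plus:
  assumes len: "\<eta> \<le> len u" "\<eta> \<le> len v"
    and ip: "ip (pt (- u)) (pt v) \<le> \<eta> / 8" "ip (pt (- v)) (pt u) \<le> \<eta> / 8"
    and \<eta>: "12 * \<delta> < \<eta>"
  shows "\<eta> < translation_length x0 (app (u + v))"
proof -
  define w where "w = u + v"
  have pos: "0 < \<eta>" using \<eta> delta_nonneg by simp
  have lw: "len w = len u + len v - 2 * ip (pt (- u)) (pt v)"
    using dist_ip[of "pt (- u)" "pt v"] dist_app_left[of "- u" x0 "pt v"] len_uminus[of u]
    by (simp add: w_def)
  have 1: "7 * \<eta> / 8 \<le> ip (pt u) (pt w)"
    using ip_translate[of u "pt v"] len ip by (simp add: w_def)
  have "- w = - v + - u" by (simp add: w_def minus_add)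
  then have "pt (- w) = - v \<triangleright> pt (- u)" by (simp only: app_plus)
  then have 2: "7 * \<eta> / 8 \<le> ip (pt (- v)) (pt (- w))"
    using ip_translate[of "- v" "pt (- u)"] len ip len_uminus[of v] ip_commute[of "pt v"] by simp
  \<comment> \<open>The point \<open>pt w\<close> is reached by way of \<open>pt u\<close>, and
    \<open>pt (- w)\<close> by way of \<open>pt (- v)\<close>, and these diverge. As
    \<open>len w\<close> is at least 7\<eta>/4, the translation length is at least 3\<eta>/2 -
    6\<delta>, which exceeds \<eta> because 12\<delta> < \<eta>.\<close>
  have "ip (pt (- w)) (pt w) \<le> \<eta> / 8 + 2 * \<delta>"
    using ip_hyperbolic[of "pt (- v)" "pt (- w)" "pt u"] ip_hyperbolic[of "pt (- w)" "pt w" "pt u"]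
      1 2 ip ip_commute[of "pt u" "pt w"] \<eta> delta_nonneg by linarith
  moreover from this have "2 * ip (pt (- w)) (pt w) + 2 * \<delta> < len w"
    using lw len ip \<eta> pos by linarith
  ultimately show ?thesis
    using translation_length_ge[of w] lw len ip \<eta> pos unfolding w_def by linarith
qed

lemma walk_translation_length_le:
  assumes H: "weighted_steps wt H"
    and n: "2 \<le> n" "36 * \<delta> < \<kappa> * real n" and \<kappa>: "0 < \<kappa>"
    and progress: "\<And>m. m = n div 2 \<or> m = n - n div 2 \<Longrightarrow>
      weighted_steps.walk wt \<iota> H m (\<lambda>x. of_bool (len x \<le> \<kappa> * real m)) \<le> e"
    and shadow: "\<And>m z. m = n div 2 \<or> m = n - n div 2 \<Longrightarrow>
      weighted_steps.walk wt \<iota> H m (\<lambda>x. of_bool (\<kappa> * real n / 24 < ip z (pt x))) \<le> e"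
  shows "weighted_steps.walk wt \<iota> H n
    (\<lambda>x. of_bool (translation_length x0 (app x) \<le> \<kappa> / 3 * real n)) \<le> 4 * e"
proof -
  interpret weighted_steps wt \<iota> H by fact
  define m where "m = n div 2"
  define m' where "m' = n - n div 2"
  have mm: "n = m + m'" "n \<le> 3 * m" "n \<le> 3 * m'" using n(1) by (auto simp: m_def m'_def)
  \<comment> \<open>For \<open>n \<ge> 2\<close> each half has at least a third of the
    steps.\<close>
  define \<eta> where "\<eta> = \<kappa> * real n / 3"
  have \<eta>: "12 * \<delta> < \<eta>" "\<eta> / 8 = \<kappa> * real n / 24" using n by (auto simp: \<eta>_def)
  have "real n / 3 \<le> real m" "real n / 3 \<le> real m'" using mm by linarith+
  then have \<eta>m: "\<eta> \<le> \<kappa> * real m" "\<eta> \<le> \<kappa> * real m'"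
    using mult_left_mono[of "real n / 3" _ \<kappa>] \<kappa> by (auto simp: \<eta>_def)
  define f1 where "f1 x = (of_bool (len x \<le> \<kappa> * real m) :: real)" for x
  define f2 where "f2 x = (of_bool (len x \<le> \<kappa> * real m') :: real)" for x
  define f3 where "f3 x y = (of_bool (\<kappa> * real n / 24 < ip (pt (- x)) (pt y)) :: real)" for x y
  define f where "f x = (of_bool (translation_length x0 (app x) \<le> \<kappa> / 3 * real n) :: real)" for x
  have e: "0 \<le> e"
    using order_trans[OF walk_nonneg progress[of m]] by (simp add: m_def)
  have "f (x + y) \<le> f1 x + (f2 y + (f3 x y + f3 y x))" for x y
  proof (cases "f1 x = 0 \<and> f2 y = 0 \<and> f3 x y = 0 \<and> f3 y x = 0")
    case True
    then have "\<eta> < translation_length x0 (app (x + y))"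
      using \<eta> \<eta>m by (intro translation_length_plus) (auto simp: f1_def f2_def f3_def)
    then have "f (x + y) = 0" by (simp add: f_def \<eta>_def)
    then show ?thesis using True by simp
  next
    case False
    have "f (x + y) \<le> 1" by (simp add: f_def)
    then show ?thesis using False unfolding f1_def f2_def f3_def by (auto simp: of_bool_def)
  qed
  then have "walk n f \<le> walk m (\<lambda>x. walk m' (\<lambda>y. f1 x + (f2 y + (f3 x y + f3 y x))))"
    unfolding mm(1) walk_add by (intro walk_mono)
  also have "\<dots> = walk m (\<lambda>x. walk m' (\<lambda>y. f1 x)) + (walk m (\<lambda>x. walk m' f2) +
      (walk m (\<lambda>x. walk m' (f3 x)) + walk m (\<lambda>x. walk m' (\<lambda>y. f3 y x))))"
    by (simp add: walk_plus)
  also have "walk m (\<lambda>x. walk m' (\<lambda>y. f1 x)) \<le> walk m f1"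
    by (intro walk_mono walk_const_le) (simp add: f1_def)
  also have "walk m f1 \<le> e" using progress[of m] by (simp add: m_def f1_def[abs_def])
  also have "walk m (\<lambda>x. walk m' f2) \<le> e"
    by (rule walk_le[OF _ e]) (use progress[of m'] in \<open>simp add: m'_def f2_def[abs_def]\<close>)
  also have "walk m (\<lambda>x. walk m' (f3 x)) \<le> e"
    by (rule walk_le[OF _ e]) (use shadow[of m'] in \<open>simp add: m'_def f3_def[abs_def]\<close>)
  also have "walk m (\<lambda>x. walk m' (\<lambda>y. f3 y x)) = walk m' (\<lambda>y. walk m (f3 y))"
    by (rule walk_swap)
  also have "\<dots> \<le> e"
    by (rule walk_le[OF _ e]) (use shadow[of m] in \<open>simp add: m_def f3_def[abs_def]\<close>)
  finally show ?thesis by (simp add: f_def)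
qed

end

context schottky_walk
begin

text \<open>The order of choices is \<open>e\<close>, \<open>k\<close>, \<open>B\<close>,
  \<open>n\<close>. With \<open>k\<close> and \<open>B\<close> fixed, the threshold in
  \<open>shadow_decay\<close> is constant and eventually falls below
  \<open>\<kappa> * n / 24\<close>.\<close>

lemma translation_length_in_probability:
  assumes F: "finite F"
    and tight: "\<And>e. 0 < e \<Longrightarrow> \<exists>B. \<forall>H. weighted_steps wt H \<longrightarrow> H \<subseteq> A \<longrightarrow> sum wt {h \<in> H. B < len (\<iota> h)} \<le> e"
  shows "\<exists>L>0. \<forall>e>0. \<exists>n0. \<forall>n\<ge>n0. \<forall>H. weighted_steps wt H \<longrightarrow> F \<subseteq> H \<longrightarrow> H \<subseteq> A \<longrightarrow>
    weighted_steps.walk wt \<iota> H n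
      (\<lambda>x. of_bool (translation_length x0 (app x) \<le> L * real n)) \<le> e"
proof -
  obtain \<kappa> K c where \<kappa>: "0 < \<kappa>" and c: "0 < K" "0 < c" "c < 1"
    and progress: "\<And>H z n. weighted_steps wt H \<Longrightarrow> F \<subseteq> H \<Longrightarrow>
      weighted_steps.walk wt \<iota> H n (\<lambda>x. of_bool (dist z (pt x) \<le> \<kappa> * real n)) \<le> K * c ^ n"
    using linear_progress by blast
  obtain r where r: "0 \<le> r"
    and shadow: "\<And>H z n k B R. weighted_steps wt H \<Longrightarrow> F \<subseteq> H \<Longrightarrow> (\<forall>h\<in>F. len (\<iota> h) \<le> B) \<Longrightarrow> 0 \<le> B \<Longrightarrow>
      k * M \<le> n \<Longrightarrow> real k * (real M * B + r) + r \<le> R \<Longrightarrow>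
      weighted_steps.walk wt \<iota> H n (\<lambda>x. of_bool (R < ip z (pt x))) \<le>
        8 * \<theta> ^ k + real (k * M) * sum wt {h \<in> H. B < len (\<iota> h)}"
    using shadow_decay by blast
  show ?thesis
  proof (intro exI[of _ "\<kappa> / 3"] conjI allI impI)
    show "0 < \<kappa> / 3" using \<kappa> by simp
    fix e :: real assume e: "0 < e"
    have "\<forall>\<^sub>F m in sequentially. K * c ^ m < e / 4"
      using c e by (intro order_tendstoD(2)[where y = "K * 0"] tendsto_intros LIMSEQ_power_zero) auto
    then obtain m0 where m0: "\<And>m. m0 \<le> m \<Longrightarrow> K * c ^ m < e / 4"
      by (auto simp: eventually_sequentially)
    have "\<forall>\<^sub>F k in sequentially. 8 * \<theta> ^ k < e / 8"
      using theta e by (intro order_tendstoD(2)[where y = "8 * 0"] tendsto_intros LIMSEQ_power_zero) auto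
    then obtain k where k: "8 * \<theta> ^ k < e / 8"
      by (auto simp: eventually_sequentially)
    define t where "t = real (k * M) + 1"
    have t: "0 < t" unfolding t_def by (intro add_nonneg_pos) auto
    define d where "d = e / (8 * t)"
    have d: "0 < d" using e t by (simp add: d_def)
    obtain B0 where B0: "\<And>H. weighted_steps wt H \<Longrightarrow> H \<subseteq> A \<Longrightarrow> sum wt {h \<in> H. B0 < len (\<iota> h)} \<le> d"
      using tight[OF d] by blast
    define B where "B = max B0 (\<Sum>h\<in>F. len (\<iota> h))"
    have B: "0 \<le> B" "\<forall>h\<in>F. len (\<iota> h) \<le> B" "B0 \<le> B"
      using F by (auto simp: B_def le_max_iff_disj intro!: sum_nonneg member_le_sum)
    obtain n1 :: nat where n1: "(36 * \<delta> + 24 * (real k * (real M * B + r) + r)) / \<kappa> < n1"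
      using reals_Archimedean2 by blast
    show "\<exists>n0. \<forall>n\<ge>n0. \<forall>H. weighted_steps wt H \<longrightarrow> F \<subseteq> H \<longrightarrow> H \<subseteq> A \<longrightarrow>
      weighted_steps.walk wt \<iota> H n
        (\<lambda>x. of_bool (translation_length x0 (app x) \<le> \<kappa> / 3 * real n)) \<le> e"
    proof (intro exI[of _ "n1 + 2 * (m0 + k * M) + 2"] allI impI)
      fix n H assume n: "n1 + 2 * (m0 + k * M) + 2 \<le> n"
        and H: "weighted_steps wt H" "F \<subseteq> H" "H \<subseteq> A"
      interpret H: weighted_steps wt \<iota> H by fact
      have "(36 * \<delta> + 24 * (real k * (real M * B + r) + r)) / \<kappa> < real n" using n1 n by linarith
      then have big: "36 * \<delta> + 24 * (real k * (real M * B + r) + r) < \<kappa> * real n"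
        using \<kappa> by (simp add: divide_less_eq mult.commute)
      define Q where "Q = real k * (real M * B + r)"
      have "0 \<le> Q" using B r by (simp add: Q_def)
      then have n\<delta>: "36 * \<delta> < \<kappa> * real n"
        using big r unfolding Q_def[symmetric] by argo
      have R: "real k * (real M * B + r) + r \<le> \<kappa> * real n / 24"
        using big delta_nonneg unfolding Q_def[symmetric] by argo
      have half: "m0 + k * M \<le> m" if "m = n div 2 \<or> m = n - n div 2" for m
        using that n by auto
      have "H.walk n (\<lambda>x. of_bool (translation_length x0 (app x) \<le> \<kappa> / 3 * real n)) \<le> 4 * (e / 4)"
      proof (rule walk_translation_length_le[OF H(1) _ n\<delta> \<kappa>])
        fix m assume m: "m = n div 2 \<or> m = n - n div 2"
        show "H.walk m (\<lambda>x. of_bool (len x \<le> \<kappa> * real m)) \<le> e / 4"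
          using progress[OF H(1,2), of m x0] m0[of m] half[OF m] by simp
        fix z
        have "H.walk m (\<lambda>x. of_bool (\<kappa> * real n / 24 < ip z (pt x))) \<le>
          8 * \<theta> ^ k + real (k * M) * sum wt {h \<in> H. B < len (\<iota> h)}"
          using half[OF m] by (intro shadow H R B) auto
        also have "sum wt {h \<in> H. B < len (\<iota> h)} \<le> sum wt {h \<in> H. B0 < len (\<iota> h)}"
          using H.finite_steps H.wt_nonneg B(3) by (intro sum_mono2) auto
        also have "\<dots> \<le> d" by (rule B0[OF H(1,3)])
        also have "real (k * M) * d \<le> t * d"
          using d by (intro mult_right_mono) (auto simp: t_def)
        also have "\<dots> = e / 8" using t by (simp add: d_def)
        finally show "H.walk m (\<lambda>x. of_bool (\<kappa> * real n / 24 < ip z (pt x))) \<le> e / 4"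
          using k by (simp add: mult_left_mono)
      qed (use n in auto)
      then show "H.walk n (\<lambda>x. of_bool (translation_length x0 (app x) \<le> \<kappa> / 3 * real n)) \<le> e"
        by simp
    qed
  qed
qed

text \<open>With one \<open>B\<close> for all steps nothing is cut off, so \<open>k\<close> may be
  proportional to \<open>n\<close> and both error terms decay exponentially.\<close>

lemma translation_length_exponential:
  assumes B: "\<And>h. h \<in> A \<Longrightarrow> len (\<iota> h) \<le> B" "0 \<le> B" and FA: "F \<subseteq> A"
  shows "\<exists>L>0. \<exists>K c n0. 0 < c \<and> c < 1 \<and> (\<forall>n\<ge>n0. \<forall>H. weighted_steps wt H \<longrightarrow> F \<subseteq> H \<longrightarrow> H \<subseteq> A \<longrightarrow>
    weighted_steps.walk wt \<iota> H n
      (\<lambda>x. of_bool (translation_length x0 (app x) \<le> L * real n)) \<le> K * c ^ n)"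
proof -
  obtain \<kappa> K c where \<kappa>: "0 < \<kappa>" and c: "0 < K" "0 < c" "c < 1"
    and progress: "\<And>H z n. weighted_steps wt H \<Longrightarrow> F \<subseteq> H \<Longrightarrow>
      weighted_steps.walk wt \<iota> H n (\<lambda>x. of_bool (dist z (pt x) \<le> \<kappa> * real n)) \<le> K * c ^ n"
    using linear_progress by blast
  obtain r where r: "0 \<le> r"
    and shadow: "\<And>H z n k B R. weighted_steps wt H \<Longrightarrow> F \<subseteq> H \<Longrightarrow> (\<forall>h\<in>F. len (\<iota> h) \<le> B) \<Longrightarrow> 0 \<le> B \<Longrightarrow>
      k * M \<le> n \<Longrightarrow> real k * (real M * B + r) + r \<le> R \<Longrightarrow>
      weighted_steps.walk wt \<iota> H n (\<lambda>x. of_bool (R < ip z (pt x))) \<le>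
        8 * \<theta> ^ k + real (k * M) * sum wt {h \<in> H. B < len (\<iota> h)}"
    using shadow_decay by blast
  define q where "q = real M * B + r"
  have q: "0 \<le> q" using B r by (simp add: q_def)
  obtain p0 :: nat where p0: "48 * q / \<kappa> < p0" using reals_Archimedean2 by blast
  \<comment> \<open>The summand \<open>2 * M\<close> keeps \<open>k * M\<close> within half of the
    walk; \<open>p0\<close> keeps \<open>k * q\<close> below \<open>\<kappa> * n / 48\<close>, half
    of the threshold, the other half being left for \<open>r\<close>.\<close>
  define p where "p = 2 * M + p0"
  have p: "0 < p" using M by (simp add: p_def)
  have pq: "48 * q \<le> \<kappa> * p"
  proof -
    have "48 * q / \<kappa> < p" using p0 by (simp add: p_def)
    then show ?thesis using \<kappa> by (simp add: divide_less_eq mult.commute)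
  qed
  define c1 where "c1 = \<theta> powr (1 / p)"
  define c2 where "c2 = c powr (1 / real 2)"
  define c' where "c' = max c1 c2"
  define K' where "K' = 8 / \<theta> + K / c"
  have c12: "0 < c1" "c1 < 1" "0 < c2" "c2 < 1"
    using theta c p powr_less_mono'[of \<theta> 0 "1 / p"] powr_less_mono'[of c 0 "1 / real 2"]
    by (auto simp: c1_def c2_def)
  have c': "0 < c'" "c' < 1" using c12 by (auto simp: c'_def)
  obtain n1 :: nat where n1: "(36 * \<delta> + 48 * r) / \<kappa> < n1" using reals_Archimedean2 by blast
  have "weighted_steps.walk wt \<iota> H n
      (\<lambda>x. of_bool (translation_length x0 (app x) \<le> \<kappa> / 3 * real n)) \<le> 4 * K' * c' ^ n"
    if n: "n1 + 2 \<le> n" and H: "weighted_steps wt H" "F \<subseteq> H" "H \<subseteq> A" for n H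
  proof -
    interpret H: weighted_steps wt \<iota> H by fact
    have "(36 * \<delta> + 48 * r) / \<kappa> < real n" using n1 n by linarith
    then have big: "36 * \<delta> + 48 * r < \<kappa> * real n"
      using \<kappa> by (simp add: divide_less_eq mult.commute)
    then have n\<delta>: "36 * \<delta> < \<kappa> * real n" using r by linarith
    define k where "k = n div p"
    have "real k * q \<le> \<kappa> * real n / 48"
    proof -
      have "real k * real p \<le> real n"
        unfolding k_def by (metis div_times_less_eq_dividend of_nat_le_iff of_nat_mult)
      then have "\<kappa> * (real k * real p) \<le> \<kappa> * real n" using \<kappa> by simp
      moreover have "real k * (48 * q) \<le> real k * (\<kappa> * p)" using pq by (intro mult_left_mono) auto
      ultimately show ?thesis by (simp add: algebra_simps)
    qed
    then have R: "real k * (real M * B + r) + r \<le> \<kappa> * real n / 24"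
      using big delta_nonneg unfolding q_def by linarith
    have kM: "k * M \<le> n div 2"
    proof -
      have "2 * (k * M) \<le> k * p" by (simp add: p_def)
      also have "\<dots> \<le> n" by (simp add: k_def)
      finally show ?thesis by simp
    qed
    have Kc: "K * c ^ (n div 2) \<le> K' * c' ^ n"
    proof -
      have "K * c ^ (n div 2) \<le> K * (1 / c * c2 ^ n)"
        using power_div_le[of c 2 n] c by (intro mult_left_mono) (auto simp: c2_def)
      also have "\<dots> = K / c * c2 ^ n" by simp
      also have "\<dots> \<le> K' * c' ^ n"
        using c theta c12 by (intro mult_mono power_mono) (auto simp: K'_def c'_def)
      finally show ?thesis .
    qed
    have \<theta>k: "8 * \<theta> ^ k \<le> K' * c' ^ n"
    proof -
      have "8 * \<theta> ^ k \<le> 8 * (1 / \<theta> * c1 ^ n)"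
        using power_div_le[OF theta p, of n] by (simp add: c1_def k_def)
      also have "\<dots> = 8 / \<theta> * c1 ^ n" by simp
      also have "\<dots> \<le> K' * c' ^ n"
        using c theta c12 by (intro mult_mono power_mono) (auto simp: K'_def c'_def)
      finally show ?thesis .
    qed
    have "H.walk n (\<lambda>x. of_bool (translation_length x0 (app x) \<le> \<kappa> / 3 * real n)) \<le> 4 * (K' * c' ^ n)"
    proof (rule walk_translation_length_le[OF H(1) _ n\<delta> \<kappa>])
      fix m assume m: "m = n div 2 \<or> m = n - n div 2"
      then have half: "n div 2 \<le> m" by auto
      have "K * c ^ m \<le> K * c ^ (n div 2)"
        using c half by (intro mult_left_mono power_decreasing) auto
      then show "H.walk m (\<lambda>x. of_bool (len x \<le> \<kappa> * real m)) \<le> K' * c' ^ n"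
        using progress[OF H(1,2), of m x0] Kc by linarith
      fix z
      have "H.walk m (\<lambda>x. of_bool (\<kappa> * real n / 24 < ip z (pt x))) \<le>
        8 * \<theta> ^ k + real (k * M) * sum wt {h \<in> H. B < len (\<iota> h)}"
        using half kM FA B by (intro shadow H R) auto
      moreover have "{h \<in> H. B < len (\<iota> h)} = {}" using H(3) B by force
      ultimately show "H.walk m (\<lambda>x. of_bool (\<kappa> * real n / 24 < ip z (pt x))) \<le> K' * c' ^ n"
        using \<theta>k by simp
    qed (use n in auto)
    then show ?thesis by simp
  qed
  moreover have "0 < \<kappa> / 3" using \<kappa> by simp
  ultimately show ?thesis using c' by blast
qed

end

section \<open>Random walks on countable groups\<close>

locale discrete_walk = group G for G (structure) +
  fixes \<mu> :: "'g measure" and \<iota> :: "'g \<Rightarrow> 'x::metric_space isom"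
  assumes countable_carrier: "countable (carrier G)"
    and prob: "prob_measure_on G \<mu>"
    and hom_one: "\<iota> \<one> = 0"
    and hom_mult: "\<And>g h. g \<in> carrier G \<Longrightarrow> h \<in> carrier G \<Longrightarrow> \<iota> (g \<otimes> h) = \<iota> g + \<iota> h"
begin

sublocale prob_space \<mu>
  using prob by (simp add: prob_measure_on_def)

lemma sets_mu: "sets \<mu> = Pow (carrier G)"
  using prob by (simp add: prob_measure_on_def)

lemma space_mu: "space \<mu> = carrier G"
  using sets_eq_imp_space_eq[of \<mu> "count_space (carrier G)"] sets_mu by simp

sublocale steps: sequence_space \<mu> ..

lemma space_step: "\<omega> \<in> space (step_space \<mu>) \<longleftrightarrow> (\<forall>i. \<omega> i \<in> carrier G)"
  by (simp add: step_space_def space_PiM space_mu PiE_iff)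

lemma random_walk_closed: "(\<And>i. \<omega> i \<in> carrier G) \<Longrightarrow> random_walk G \<omega> n \<in> carrier G"
  by (induction n) auto

text \<open>Reconciles \<open>random_walk\<close>, which appends steps, with \<open>walk\<close>,
  which prepends them.\<close>

lemma random_walk_case_nat:
  "(\<And>i. \<omega> i \<in> carrier G) \<Longrightarrow> s \<in> carrier G \<Longrightarrow>
    random_walk G (case_nat s \<omega>) (Suc n) = s \<otimes> random_walk G \<omega> n"
  by (induction n) (simp_all add: m_assoc random_walk_closed)

lemma measurable_random_walk: "(\<lambda>\<omega>. random_walk G \<omega> n) \<in> measurable (step_space \<mu>) \<mu>"
proof (induction n)
  case 0
  show ?case by (simp add: space_mu)
next
  case (Suc n)
  \<comment> \<open>Countability of the carrier makes multiplication measurable for the product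
    sigma-algebra.\<close>
  have "(\<lambda>p. fst p \<otimes> snd p) \<in> measurable (count_space (carrier G) \<Otimes>\<^sub>M \<mu>) \<mu>"
    using countable_carrier
    by (intro measurable_pair_measure_countable1) (auto simp: measurable_def sets_mu space_mu)
  moreover have "sets (count_space (carrier G) \<Otimes>\<^sub>M \<mu>) = sets (\<mu> \<Otimes>\<^sub>M \<mu>)"
    by (intro sets_pair_measure_cong) (simp_all add: sets_mu)
  ultimately have mult: "(\<lambda>p. fst p \<otimes> snd p) \<in> measurable (\<mu> \<Otimes>\<^sub>M \<mu>) \<mu>"
    by (simp cong: measurable_cong_sets)
  have "(\<lambda>\<omega>. \<omega> n) \<in> measurable (step_space \<mu>) \<mu>" by (simp add: step_space_def)
  then have "(\<lambda>\<omega>. (random_walk G \<omega> n, \<omega> n)) \<in> measurable (step_space \<mu>) (\<mu> \<Otimes>\<^sub>M \<mu>)"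
    using Suc by (rule measurable_Pair[rotated])
  from measurable_compose[OF this mult] show ?case by simp
qed

definition wt :: "'g \<Rightarrow> real" where "wt g = measure \<mu> {g}"

lemma sum_wt: "finite H \<Longrightarrow> H \<subseteq> carrier G \<Longrightarrow> sum wt H = measure \<mu> H"
  unfolding wt_def by (intro finite_measure_eq_sum_singleton[symmetric]) (auto simp: sets_mu)

lemma weighted_steps_wt: "finite H \<Longrightarrow> H \<subseteq> carrier G \<Longrightarrow> weighted_steps wt H"
  by unfold_locales (simp_all add: sum_wt, simp add: wt_def)

lemma walk_event_measurable: "{\<omega> \<in> space (step_space \<mu>). Q (\<iota> (random_walk G \<omega> n))} \<in> sets (step_space \<mu>)"
proof -
  have "{\<omega> \<in> space (step_space \<mu>). Q (\<iota> (random_walk G \<omega> n))} =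
    (\<lambda>\<omega>. random_walk G \<omega> n) -` {g \<in> carrier G. Q (\<iota> g)} \<inter> space (step_space \<mu>)"
    by (auto simp: space_step random_walk_closed)
  also have "\<dots> \<in> sets (step_space \<mu>)"
    by (rule measurable_sets[OF measurable_random_walk]) (auto simp: sets_mu)
  finally show ?thesis .
qed

lemma emeasure_random_walk_Suc:
  "emeasure (step_space \<mu>) {\<omega> \<in> space (step_space \<mu>). Q (\<iota> (random_walk G \<omega> (Suc n)))} =
    (\<integral>\<^sup>+ s. emeasure (step_space \<mu>)
      {\<omega> \<in> space (step_space \<mu>). Q (\<iota> s + \<iota> (random_walk G \<omega> n))} \<partial>\<mu>)"
proof -
  let ?S = "step_space \<mu>"
  let ?X = "{\<omega> \<in> space ?S. Q (\<iota> (random_walk G \<omega> (Suc n)))}"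
  let ?f = "\<lambda>(s, \<omega>). case_nat s \<omega>"
  interpret S: prob_space ?S
    unfolding step_space_def by (rule steps.P.prob_space_axioms)
  have f: "?f \<in> measurable (\<mu> \<Otimes>\<^sub>M ?S) ?S" unfolding step_space_def by measurable
  have X: "?X \<in> sets ?S" by (rule walk_event_measurable)
  have "emeasure ?S ?X = emeasure (distr (\<mu> \<Otimes>\<^sub>M ?S) ?S ?f) ?X"
    using steps.PiM_iter by (simp add: step_space_def)
  also have "\<dots> = emeasure (\<mu> \<Otimes>\<^sub>M ?S) (?f -` ?X \<inter> space (\<mu> \<Otimes>\<^sub>M ?S))"
    by (rule emeasure_distr[OF f X])
  also have "\<dots> = (\<integral>\<^sup>+ s. emeasure ?S (Pair s -` (?f -` ?X \<inter> space (\<mu> \<Otimes>\<^sub>M ?S))) \<partial>\<mu>)"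
    by (rule S.emeasure_pair_measure_alt) (rule measurable_sets[OF f X])
  also have "\<dots> = (\<integral>\<^sup>+ s. emeasure ?S {\<omega> \<in> space ?S. Q (\<iota> s + \<iota> (random_walk G \<omega> n))} \<partial>\<mu>)"
  proof (intro nn_integral_cong arg_cong[of _ _ "emeasure ?S"])
    fix s assume "s \<in> space \<mu>"
    then have s: "s \<in> carrier G" by (simp add: space_mu)
    have "case_nat s \<omega> \<in> space ?S" if "\<omega> \<in> space ?S" for \<omega>
      using that s by (auto simp: space_step split: nat.split)
    moreover have "random_walk G (case_nat s \<omega>) (Suc n) = s \<otimes> random_walk G \<omega> n"
      "random_walk G \<omega> n \<in> carrier G" if "\<omega> \<in> space ?S" for \<omega>
      using that s random_walk_case_nat[of \<omega> s n] random_walk_closed by (auto simp: space_step)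
    ultimately show "Pair s -` (?f -` ?X \<inter> space (\<mu> \<Otimes>\<^sub>M ?S)) =
      {\<omega> \<in> space ?S. Q (\<iota> s + \<iota> (random_walk G \<omega> n))}"
      using s hom_mult by (auto simp: space_pair_measure space_mu simp del: random_walk.simps)
  qed
  finally show ?thesis .
qed

text \<open>Union bound: each of the \<open>n\<close> steps falls outside \<open>H\<close> with
  probability \<open>1 - sum wt H\<close>.\<close>

lemma prob_random_walk_le:
  assumes H: "finite H" "H \<subseteq> carrier G"
  shows "emeasure (step_space \<mu>) {\<omega> \<in> space (step_space \<mu>). Q (\<iota> (random_walk G \<omega> n))} \<le>
    ennreal (weighted_steps.walk wt \<iota> H n (\<lambda>x. of_bool (Q x)) + real n * (1 - sum wt H))"
proof -
  interpret H: weighted_steps wt \<iota> H using weighted_steps_wt[OF H] .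
  interpret S: prob_space "step_space \<mu>"
    unfolding step_space_def by (rule steps.P.prob_space_axioms)
  define r where "r = 1 - sum wt H"
  have r: "0 \<le> r" using H.wt_sum by (simp add: r_def)
  have rest: "emeasure \<mu> (carrier G - H) = ennreal r"
    using prob_compl[of H] H by (simp add: emeasure_eq_measure space_mu sets_mu r_def sum_wt)
  show ?thesis
    unfolding r_def[symmetric]
  proof (induction n arbitrary: Q)
    case 0
    show ?case
    proof (cases "Q 0")
      case True
      then show ?thesis using S.prob_le_1 by (simp add: hom_one S.emeasure_space_1)
    qed (simp add: hom_one)
  next
    case (Suc n)
    define a where "a h = H.walk n (\<lambda>y. of_bool (Q (\<iota> h + y)))" for h
    have a: "0 \<le> a h" for h unfolding a_def by (rule H.walk_nonneg) simp
    have "emeasure (step_space \<mu>) {\<omega> \<in> space (step_space \<mu>). Q (\<iota> (random_walk G \<omega> (Suc n)))} =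
      (\<integral>\<^sup>+ s. emeasure (step_space \<mu>)
        {\<omega> \<in> space (step_space \<mu>). Q (\<iota> s + \<iota> (random_walk G \<omega> n))} \<partial>\<mu>)"
      by (rule emeasure_random_walk_Suc)
    also have "\<dots> \<le> (\<integral>\<^sup>+ s. (\<Sum>h\<in>H. ennreal (a h) * indicator {h} s) +
        indicator (carrier G - H) s + ennreal (real n * r) \<partial>\<mu>)"
    proof (rule nn_integral_mono)
      fix s assume s: "s \<in> space \<mu>"
      let ?p = "emeasure (step_space \<mu>)
        {\<omega> \<in> space (step_space \<mu>). Q (\<iota> s + \<iota> (random_walk G \<omega> n))}"
      show "?p \<le> (\<Sum>h\<in>H. ennreal (a h) * indicator {h} s) +
        indicator (carrier G - H) s + ennreal (real n * r)"
      proof (cases "s \<in> H")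
        case True
        have "?p \<le> ennreal (a s + real n * r)"
          using Suc.IH[of "\<lambda>x. Q (\<iota> s + x)"] by (simp add: a_def)
        also have "\<dots> = ennreal (a s) + ennreal (real n * r)" using a r by simp
        also have "ennreal (a s) = (\<Sum>h\<in>H. ennreal (a h) * indicator {h} s)"
          using True H(1) by (simp add: indicator_def if_distrib cong: if_cong)
        finally show ?thesis using True by simp
      next
        case False
        have "?p \<le> 1" by (rule S.emeasure_le_1)
        then show ?thesis using False s
          by (simp add: space_mu add.commute add.left_commute add_increasing2)
      qed
    qed
    also have "\<dots> = (\<Sum>h\<in>H. ennreal (a h) * emeasure \<mu> {h}) + emeasure \<mu> (carrier G - H) +
        ennreal (real n * r)"
    proof -
      have meas: "f \<in> borel_measurable \<mu>" for f :: "'g \<Rightarrow> ennreal"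
        by (auto simp: measurable_def sets_mu space_mu)
      have "{h} \<in> sets \<mu>" if "h \<in> H" for h using that H by (auto simp: sets_mu)
      moreover have "carrier G - H \<in> sets \<mu>" by (simp add: sets_mu)
      ultimately show ?thesis
        by (simp add: nn_integral_add[OF meas meas] nn_integral_sum[OF meas]
            nn_integral_cmult_indicator emeasure_space_1)
    qed
    also have "\<dots> = ennreal ((\<Sum>h\<in>H. a h * wt h) + r + real n * r)"
    proof -
      have "(\<Sum>h\<in>H. ennreal (a h) * emeasure \<mu> {h}) = ennreal (\<Sum>h\<in>H. a h * wt h)"
        using a by (simp add: emeasure_eq_measure wt_def ennreal_mult' sum_ennreal[symmetric] del: sum_ennreal)
      moreover have "0 \<le> (\<Sum>h\<in>H. a h * wt h)"
        using a by (intro sum_nonneg mult_nonneg_nonneg) (auto simp: wt_def)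
      ultimately show ?thesis using r by (simp add: rest)
    qed
    finally show ?case by (simp add: a_def algebra_simps)
  qed
qed

lemma atoms_eq: "atoms \<mu> = {g \<in> carrier G. 0 < wt g}"
  by (simp add: atoms_def space_mu wt_def)

section \<open>Passage from finite sets of steps to the full measure\<close>

lemma finite_approximation:
  assumes F: "finite F" "F \<subseteq> atoms \<mu>" and e: "0 < e"
  shows "\<exists>H. finite H \<and> F \<subseteq> H \<and> H \<subseteq> atoms \<mu> \<and> 1 - sum wt H \<le> e"
proof -
  obtain f :: "nat \<Rightarrow> 'g" where f: "carrier G \<subseteq> range f"
    using countable_carrier one_closed by (metis empty_iff order_refl range_from_nat_into)
  define A where "A n = f ` {..n} \<inter> carrier G" for n
  have "(\<lambda>n. measure \<mu> (A n)) \<longlonglongrightarrow> measure \<mu> (\<Union>n. A n)"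
    by (rule finite_Lim_measure_incseq) (auto simp: A_def sets_mu incseq_def)
  moreover have "(\<Union>n. A n) = carrier G"
  proof (intro equalityI subsetI)
    fix g assume g: "g \<in> carrier G"
    then obtain n where "g = f n" using f by blast
    then have "g \<in> A n" using g by (simp add: A_def)
    then show "g \<in> (\<Union>n. A n)" by blast
  qed (auto simp: A_def)
  ultimately have "(\<lambda>n. measure \<mu> (A n)) \<longlonglongrightarrow> 1" using prob_space by (simp add: space_mu)
  then obtain n where n: "1 - e < measure \<mu> (A n)"
    using e order_tendstoD(1)[of _ 1 sequentially "1 - e"] by (auto simp: eventually_sequentially)
  define H where "H = F \<union> (A n \<inter> atoms \<mu>)"
  have An: "finite (A n)" "A n \<subseteq> carrier G" by (auto simp: A_def)
  have "measure \<mu> (A n) = sum wt (A n)" using sum_wt An by simp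
  also have "\<dots> = sum wt (A n \<inter> atoms \<mu>)"
  proof (rule sum.mono_neutral_right)
    show "\<forall>i\<in>A n - A n \<inter> atoms \<mu>. wt i = 0"
      using An measure_nonneg[of \<mu>] by (auto simp: atoms_eq wt_def intro: order_antisym)
  qed (use An in auto)
  also have "\<dots> \<le> sum wt H"
    using F An by (intro sum_mono2) (auto simp: H_def wt_def)
  finally have "1 - sum wt H \<le> e" using n by simp
  then show ?thesis using F An by (intro exI[of _ H]) (auto simp: H_def)
qed

text \<open>One finite set \<open>H0\<close> carries all but \<open>e\<close> of the mass, and
  \<open>B\<close> bounds its steps. Longer steps of any \<open>H\<close> are disjoint from
  \<open>H0\<close>, so \<open>B\<close> is independent of \<open>H\<close>.\<close>

lemma tight:
  assumes "0 < e"
  shows "\<exists>B. \<forall>H. weighted_steps wt H \<longrightarrow> H \<subseteq> atoms \<mu> \<longrightarrow>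
    sum wt {h \<in> H. B < dist x0 (\<iota> h \<triangleright> x0)} \<le> e"
proof -
  obtain H0 where H0: "finite H0" "H0 \<subseteq> atoms \<mu>" "1 - sum wt H0 \<le> e"
    using finite_approximation[of "{}" e] assms by auto
  define B where "B = (\<Sum>h\<in>H0. dist x0 (\<iota> h \<triangleright> x0))"
  have B: "dist x0 (\<iota> h \<triangleright> x0) \<le> B" if "h \<in> H0" for h
    unfolding B_def using that H0(1) by (intro member_le_sum) auto
  have "sum wt {h \<in> H. B < dist x0 (\<iota> h \<triangleright> x0)} \<le> e" if H: "weighted_steps wt H" "H \<subseteq> atoms \<mu>" for H
  proof -
    interpret H: weighted_steps wt \<iota> H by fact
    let ?X = "{h \<in> H. B < dist x0 (\<iota> h \<triangleright> x0)}"
    have "sum wt ?X + sum wt H0 = sum wt (?X \<union> H0)"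
      using H0(1) H.finite_steps B by (intro sum.union_disjoint[symmetric]) force+
    also have "\<dots> = measure \<mu> (?X \<union> H0)"
      using H0 H H.finite_steps by (intro sum_wt) (auto simp: atoms_eq)
    also have "\<dots> \<le> 1" by (rule prob_le_1)
    finally show ?thesis using H0(3) by simp
  qed
  then show ?thesis by blast
qed

lemma random_walk_le_limit:
  assumes F: "finite F" "F \<subseteq> atoms \<mu>"
    and walk: "\<And>H. weighted_steps wt H \<Longrightarrow> F \<subseteq> H \<Longrightarrow> H \<subseteq> atoms \<mu> \<Longrightarrow>
      weighted_steps.walk wt \<iota> H n (\<lambda>x. of_bool (Q x)) \<le> p"
  shows "measure (step_space \<mu>) {\<omega> \<in> space (step_space \<mu>). Q (\<iota> (random_walk G \<omega> n))} \<le> p"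
proof (rule field_le_epsilon)
  fix e :: real assume e: "0 < e"
  interpret S: prob_space "step_space \<mu>"
    unfolding step_space_def by (rule steps.P.prob_space_axioms)
  \<comment> \<open>Here \<open>H\<close> may depend on \<open>n\<close>, so the missing mass can be
    made small even after multiplication by \<open>n\<close>.\<close>
  obtain H where H: "finite H" "F \<subseteq> H" "H \<subseteq> atoms \<mu>" "1 - sum wt H \<le> e / (real n + 1)"
    using finite_approximation[OF F, of "e / (real n + 1)"] e by auto
  have HG: "H \<subseteq> carrier G" using H by (auto simp: atoms_eq)
  interpret H: weighted_steps wt \<iota> H using weighted_steps_wt[OF H(1) HG] .
  let ?P = "measure (step_space \<mu>) {\<omega> \<in> space (step_space \<mu>). Q (\<iota> (random_walk G \<omega> n))}"
  have "real n * (1 - sum wt H) \<le> (real n + 1) * (e / (real n + 1))"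
    using H(4) H.wt_sum by (intro mult_mono) auto
  then have "real n * (1 - sum wt H) \<le> e" by simp
  moreover have "?P \<le> H.walk n (\<lambda>x. of_bool (Q x)) + real n * (1 - sum wt H)"
  proof -
    have "0 \<le> H.walk n (\<lambda>x. of_bool (Q x)) + real n * (1 - sum wt H)"
      using H.wt_sum by (intro add_nonneg_nonneg H.walk_nonneg mult_nonneg_nonneg) auto
    then show ?thesis
      using prob_random_walk_le[OF H(1) HG, of Q n] by (simp add: S.emeasure_eq_measure)
  qed
  moreover have "H.walk n (\<lambda>x. of_bool (Q x)) \<le> p"
    using walk H weighted_steps_wt[OF H(1) HG] by blast
  ultimately show "?P \<le> p + e" by linarith
qed

lemma semigroup_words:
  "s \<in> generated_semigroup G (atoms \<mu>) \<Longrightarrow> s \<in> carrier G \<and> (\<exists>n\<ge>1. \<iota> s \<in> words \<iota> (atoms \<mu>) n)"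
proof (induction rule: generated_semigroup.induct)
  case (incl s)
  then have "\<iota> s \<in> words \<iota> (atoms \<mu>) (Suc 0)" by force
  then have "\<exists>n\<ge>1. \<iota> s \<in> words \<iota> (atoms \<mu>) n" by (intro exI[of _ "Suc 0"]) simp
  then show ?case using incl by (simp add: atoms_eq)
next
  case (mult a b)
  then obtain m n where "m \<ge> 1" "\<iota> a \<in> words \<iota> (atoms \<mu>) m" "n \<ge> 1" "\<iota> b \<in> words \<iota> (atoms \<mu>) n"
    by auto
  then have "\<iota> (a \<otimes> b) \<in> words \<iota> (atoms \<mu>) (m + n)" "m + n \<ge> 1"
    using mult words_plus by (auto simp: hom_mult)
  then show ?case using mult by blast
qed

end

text \<open>A pair of letters takes \<open>2 * M\<close> steps. Its weight is at least the square of
  the smallest constant that \<open>walk_ge_word\<close> gives for the 200 letters.\<close>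

lemma (in four_point_space) schottky_walk_exists:
  fixes \<sigma> :: "nat \<Rightarrow> 'x isom" and \<iota> :: "'g \<Rightarrow> 'x isom"
  assumes "schottky C 200 \<sigma>" "1 \<le> M" "\<And>i. i < 200 \<Longrightarrow> \<sigma> i \<in> words \<iota> A M"
    and wt: "\<And>h. h \<in> A \<Longrightarrow> 0 < wt h"
  shows "\<exists>F \<alpha>. finite F \<and> F \<subseteq> A \<and> schottky_walk x0 \<delta> C \<sigma> wt \<iota> F (2 * M) \<alpha>"
proof -
  define P where "P i F c \<longleftrightarrow> finite F \<and> F \<subseteq> A \<and> 0 < c \<and> (\<forall>H f. weighted_steps wt H \<longrightarrow> F \<subseteq> H \<longrightarrow>
    (\<forall>y. 0 \<le> f y) \<longrightarrow> c * f (\<sigma> i) \<le> weighted_steps.walk wt \<iota> H M f)" for i F c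
  have "\<forall>i\<in>{..<200::nat}. \<exists>F c. P i F c"
    unfolding P_def using walk_ge_word[of _ \<iota> A M wt] assms(3) wt by simp
  then obtain Fs where "\<forall>i\<in>{..<200::nat}. \<exists>c. P i (Fs i) c" by metis
  then obtain cs where "\<forall>i\<in>{..<200::nat}. P i (Fs i) (cs i)" by metis
  then have P: "P i (Fs i) (cs i)" if "i < 200" for i using that by simp
  have Fs: "finite (Fs i) \<and> Fs i \<subseteq> A \<and> 0 < cs i" if "i < 200" for i
    using P[OF that] by (simp add: P_def)
  have le: "cs i * f (\<sigma> i) \<le> weighted_steps.walk wt \<iota> H M f"
    if "i < 200" "weighted_steps wt H" "Fs i \<subseteq> H" "\<forall>y. 0 \<le> f y" for i H f
    using P[OF that(1)] that(2-4) by (simp add: P_def)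
  define F where "F = (\<Union>i<200. Fs i)"
  define a where "a = min 1 (Min (cs ` {..<200}))"
  have a: "0 < a" "a \<le> 1" "\<And>i. i < 200 \<Longrightarrow> a \<le> cs i"
  proof -
    have "0 < Min (cs ` {..<200})" using Fs by (subst Min_gr_iff) (auto simp: lessThan_empty_iff)
    then show "0 < a" by (simp add: a_def)
    show "a \<le> 1" by (simp add: a_def)
    show "a \<le> cs i" if "i < 200" for i using that by (auto simp: a_def min_le_iff_disj)
  qed
  have "schottky_walk x0 \<delta> C \<sigma> wt \<iota> F (2 * M) (a * a)"
  proof unfold_locales
    show "0 < a * a" "a * a \<le> 1" using a mult_le_one[of a a] by auto
    show "0 < 2 * M" using assms(2) by simp
    fix H and f :: "'x isom \<Rightarrow> real" and i j :: nat
    assume H: "weighted_steps wt H" "F \<subseteq> H" and f: "\<And>y. 0 \<le> f y" and ij: "i < 200" "j < 200"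
    interpret weighted_steps wt \<iota> H by fact
    have one: "a * g (\<sigma> i) \<le> walk M g" if "i < 200" "\<And>y. 0 \<le> g y" for g i
    proof -
      have "a * g (\<sigma> i) \<le> cs i * g (\<sigma> i)" using a(3) that by (intro mult_right_mono) auto
      also have "\<dots> \<le> walk M g" using that H by (intro le) (auto simp: F_def)
      finally show ?thesis .
    qed
    have "a * a * f (\<sigma> i + \<sigma> j) \<le> a * walk M (\<lambda>y. f (\<sigma> i + y))"
      using one[OF ij(2), of "\<lambda>y. f (\<sigma> i + y)"] f a by (simp add: mult.assoc)
    also have "\<dots> \<le> walk M (\<lambda>x. walk M (\<lambda>y. f (x + y)))"
      using f by (intro one ij walk_nonneg)
    also have "\<dots> = walk (2 * M) f" by (simp add: mult_2 walk_add)
    finally show "a * a * f (\<sigma> i + \<sigma> j) \<le> walk (2 * M) f" .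
  qed (use assms(1) in auto)
  moreover have "finite F" "F \<subseteq> A" using Fs by (auto simp: F_def)
  ultimately show ?thesis by blast
qed

theorem theorem1p4:
  fixes G :: "('g, 'b) monoid_scheme"
    and \<phi> :: "'g \<Rightarrow> 'x::metric_space \<Rightarrow> 'x"
    and \<mu> :: "'g measure"
    and x0 :: 'x
  assumes "group G"
    and "countable (carrier G)"
    and "gromov_hyperbolic TYPE('x)"
    and "separable_space (euclidean :: 'x topology)"
    and "isometric_action G \<phi>"
    and "prob_measure_on G \<mu>"
    and "non_elementary_measure G x0 \<phi> \<mu>"
  shows "(\<exists>L>0. (\<lambda>n. short_translation_prob G x0 \<phi> \<mu> L n) \<longlonglongrightarrow> 0) \<and>
         (bounded ((\<lambda>g. \<phi> g x0) ` atoms \<mu>) \<longrightarrow>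
           (\<exists>c K L :: real. c < 1 \<and> L > 0 \<and>
              (\<forall>n. short_translation_prob G x0 \<phi> \<mu> L n \<le> K * c ^ n)))"
proof -
  obtain \<delta> where "0 \<le> \<delta>" "four_point TYPE('x) \<delta>"
    using gromov_hyperbolic_imp_four_point[OF assms(3)] by blast
  then interpret four_point_space x0 \<delta> by unfold_locales
  interpret group G by fact
  interpret act: group_action G UNIV \<phi> using assms(5) by (simp add: isometric_action_def)
  define \<iota> where "\<iota> g = Isom (\<phi> g)" for g
  have app_\<iota>: "app (\<iota> g) = \<phi> g" if "g \<in> carrier G" for g
    unfolding \<iota>_def using assms(5) act.bij_prop0[OF that] that
    by (intro Isom_inverse) (auto simp: isometric_action_def Bij_def)
  interpret discrete_walk G \<mu> \<iota>
  proof unfold_locales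
    have "\<iota> \<one>\<^bsub>G\<^esub> \<triangleright> x = 0 \<triangleright> x" for x
      using fun_cong[OF act.id_eq_one, of x] by (simp add: app_\<iota>)
    then show "\<iota> \<one>\<^bsub>G\<^esub> = 0" by (metis app_inject ext)
    fix g h assume gh: "g \<in> carrier G" "h \<in> carrier G"
    then have "\<iota> (g \<otimes>\<^bsub>G\<^esub> h) \<triangleright> x = (\<iota> g + \<iota> h) \<triangleright> x" for x
      using act.composition_rule[of x g h] by (simp add: app_\<iota>)
    then show "\<iota> (g \<otimes>\<^bsub>G\<^esub> h) = \<iota> g + \<iota> h" by (metis app_inject ext)
  qed (use assms in auto)
  obtain g h where gh: "g \<in> generated_semigroup G (atoms \<mu>)" "h \<in> generated_semigroup G (atoms \<mu>)"
    and lox: "loxodromic x0 (\<phi> g)" "loxodromic x0 (\<phi> h)"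
    and disj: "boundary_fixed_points x0 (\<phi> g) \<inter> boundary_fixed_points x0 (\<phi> h) = {}"
    using assms(7) by (auto simp: non_elementary_measure_def non_elementary_def)
  obtain p q where pq: "1 \<le> p" "\<iota> g \<in> words \<iota> (atoms \<mu>) p" "1 \<le> q" "\<iota> h \<in> words \<iota> (atoms \<mu>) q"
    using semigroup_words[OF gh(1)] semigroup_words[OF gh(2)] by blast
  have "app (\<iota> g) = \<phi> g" "app (\<iota> h) = \<phi> h" using semigroup_words gh app_\<iota> by auto
  note schottky = schottky_exists[of "\<iota> g" "\<iota> h" "words \<iota> (atoms \<mu>)" p q 200, unfolded this,
      OF lox disj words_plus pq(2,1,4,3)]
  obtain C \<sigma> M where \<sigma>: "schottky C 200 \<sigma>" "1 \<le> M" "\<And>i. i < 200 \<Longrightarrow> \<sigma> i \<in> words \<iota> (atoms \<mu>) M"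
    using schottky by blast
  obtain F \<alpha> where F: "finite F" "F \<subseteq> atoms \<mu>" and "schottky_walk x0 \<delta> C \<sigma> wt \<iota> F (2 * M) \<alpha>"
    using schottky_walk_exists[OF \<sigma>, of wt] by (auto simp: atoms_eq)
  then interpret W: schottky_walk x0 \<delta> C \<sigma> wt \<iota> F "2 * M" \<alpha> by blast
  have short: "short_translation_prob G x0 \<phi> \<mu> L n = measure (step_space \<mu>)
      {\<omega> \<in> space (step_space \<mu>). translation_length x0 (app (\<iota> (random_walk G \<omega> n))) \<le> L * real n}" for L n
    unfolding short_translation_prob_def
    by (intro arg_cong[of _ _ "measure _"] Collect_cong conj_cong refl)
      (simp add: app_\<iota> space_step random_walk_closed)
  have short_nonneg: "0 \<le> short_translation_prob G x0 \<phi> \<mu> L n" for L n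
    by (simp add: short_translation_prob_def)
  have short_le_1: "short_translation_prob G x0 \<phi> \<mu> L n \<le> 1" for L n
  proof -
    interpret S: prob_space "step_space \<mu>"
      unfolding step_space_def by (rule steps.P.prob_space_axioms)
    show ?thesis by (simp add: short_translation_prob_def)
  qed
  have short_le: "short_translation_prob G x0 \<phi> \<mu> L n \<le> e"
    if "\<And>H. weighted_steps wt H \<Longrightarrow> F \<subseteq> H \<Longrightarrow> H \<subseteq> atoms \<mu> \<Longrightarrow>
      weighted_steps.walk wt \<iota> H n
        (\<lambda>x. of_bool (translation_length x0 (app x) \<le> L * real n)) \<le> e" for L n e
    unfolding short using random_walk_le_limit[OF F that] .
  show ?thesis
  proof (intro conjI impI)
    obtain L where L: "0 < L" and walk: "\<And>e. 0 < e \<Longrightarrow> \<exists>n0. \<forall>n\<ge>n0. \<forall>H. weighted_steps wt H \<longrightarrow>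
        F \<subseteq> H \<longrightarrow> H \<subseteq> atoms \<mu> \<longrightarrow> weighted_steps.walk wt \<iota> H n
          (\<lambda>x. of_bool (translation_length x0 (app x) \<le> L * real n)) \<le> e"
      using W.translation_length_in_probability[OF F(1) tight] by blast
    have "(\<lambda>n. short_translation_prob G x0 \<phi> \<mu> L n) \<longlonglongrightarrow> 0"
    proof (rule LIMSEQ_I)
      fix e :: real assume "0 < e"
      then obtain n0 where n0: "\<forall>n\<ge>n0. \<forall>H. weighted_steps wt H \<longrightarrow> F \<subseteq> H \<longrightarrow> H \<subseteq> atoms \<mu> \<longrightarrow>
          weighted_steps.walk wt \<iota> H n
            (\<lambda>x. of_bool (translation_length x0 (app x) \<le> L * real n)) \<le> e / 2"
        using walk[of "e / 2"] by auto
      have "norm (short_translation_prob G x0 \<phi> \<mu> L n - 0) < e" if "n0 \<le> n" for n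
      proof -
        have "short_translation_prob G x0 \<phi> \<mu> L n \<le> e / 2"
          using n0 that by (intro short_le) blast
        then show ?thesis using \<open>0 < e\<close> short_nonneg[of L n] by simp
      qed
      then show "\<exists>n0. \<forall>n\<ge>n0. norm (short_translation_prob G x0 \<phi> \<mu> L n - 0) < e" by blast
    qed
    then show "\<exists>L>0. (\<lambda>n. short_translation_prob G x0 \<phi> \<mu> L n) \<longlonglongrightarrow> 0" using L by blast
  next
    assume "bounded ((\<lambda>g. \<phi> g x0) ` atoms \<mu>)"
    then obtain B where "\<And>g. g \<in> atoms \<mu> \<Longrightarrow> dist x0 (\<phi> g x0) \<le> B"
      unfolding bounded_any_center[of _ x0] by auto
    then have B: "len (\<iota> g) \<le> max 0 B" if "g \<in> atoms \<mu>" for g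
      using that by (fastforce simp: app_\<iota> atoms_eq)
    obtain L K c n0 where L: "0 < L" and c: "0 < c" "c < 1"
      and walk: "\<And>n H. n0 \<le> n \<Longrightarrow> weighted_steps wt H \<Longrightarrow> F \<subseteq> H \<Longrightarrow> H \<subseteq> atoms \<mu> \<Longrightarrow>
        weighted_steps.walk wt \<iota> H n
          (\<lambda>x. of_bool (translation_length x0 (app x) \<le> L * real n)) \<le> K * c ^ n"
      using W.translation_length_exponential[OF B _ F(2)] by (metis max.cobounded1)
    \<comment> \<open>The finitely many \<open>n\<close> below \<open>n0\<close> are covered by
      \<open>1 / c ^ n0\<close>, which makes the right-hand side at least 1 there.\<close>
    have "short_translation_prob G x0 \<phi> \<mu> L n \<le> max K (1 / c ^ n0) * c ^ n" for n
    proof (cases "n0 \<le> n")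
      case True
      then have "short_translation_prob G x0 \<phi> \<mu> L n \<le> K * c ^ n"
        using walk by (intro short_le)
      also have "\<dots> \<le> max K (1 / c ^ n0) * c ^ n" using c by (intro mult_right_mono) auto
      finally show ?thesis .
    next
      case False
      then have "c ^ n0 \<le> c ^ n" using c by (intro power_decreasing) auto
      then have "1 \<le> 1 / c ^ n0 * c ^ n" using c by (simp add: le_divide_eq)
      also have "\<dots> \<le> max K (1 / c ^ n0) * c ^ n" using c by (intro mult_right_mono) auto
      finally show ?thesis using short_le_1[of L n] by linarith
    qed
    then show "\<exists>c K L :: real. c < 1 \<and> L > 0 \<and>
        (\<forall>n. short_translation_prob G x0 \<phi> \<mu> L n \<le> K * c ^ n)"
      using L c by blast
  qed
qed

end
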